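(* Let $e,\ell\ge2$ be integers and let $\mathcal{A}$ and $\mathcal{A}'$ be $\ell$-abaci. There is an arrow $\mathcal{A}\to\mathcal{A}'$ in the $\mathfrak{sl}_\infty$-crystal if and only if the following equivalent situations hold for some $k\in\mathbb{N}$: (1) (traveling downstream) $\mathcal{A}'$ is obtained from $\mathcal{A}$ by shifting the $k$'th fore period $P_k$ of $\mathcal{A}$ one unit to the right, and the right shift $\tilde P_k$ of $P_k$ is equal to $Q_k'$, the $k$'th aft period of $\mathcal{A}'$. (2) (traveling upstream) $\mathcal{A}$ is obtained from $\mathcal{A}'$ by shifting the $k$'th aft period $Q_k'$ of $\mathcal{A}'$ one unit to the left, and the left shift $\tilde Q_k'$ of $Q_k'$ is equal to $P_k$, the $k$'th fore period of $\mathcal{A}$. In this case, $\mathcal{A}'=\Upsilon_k^+\mathcal{A}$, or equivalently $\mathcal{A}=\Upsilon_k^-\mathcal{A}'$.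
   Context: Throughout $e,\ell\ge 2$ are fixed integers and $\mathbb{N}=\{1,2,\dots\}$. Abaci. An $\ell$-abacus is a subset $\mathcal{A}\subset\mathbb{Z}\times\{1,\dots,\ell\}$ such that for some $m_-,m_+\in\mathbb{Z}$ and all $j$: $(\beta,j)\in\mathcal{A}$ for all $\beta\le m_-$ and $(\beta,j)\notin\mathcal{A}$ for all $\beta\ge m_+$. Elements $b=(\beta,j)\in\mathcal{A}$ are beads, in column $\beta(b)=\beta$ and row $j(b)=j$ (row 1 is the bottom row); pairs not in $\mathcal{A}$ are spaces. For $\mathbf{s}\in\mathbb{Z}^\ell$ and an $\ell$-partition $\boldsymbol\lambda=(\lambda^1,\dots,\lambda^\ell)$ put $\mathcal{A}(\boldsymbol\lambda,\mathbf{s})=\{(\lambda^j_k+s_j-k+1,j)\mid 1\le j\le\ell,\ k\ge 1\}$. Every $\ell$-abacus is of this form for a unique pair $(\boldsymbol\lambda,\mathbf{s})$; $\mathbf{s}$ is its charge. Quasiperiods. Beads are totally ordered by: $b<b'$ iff $\beta(b)<\beta(b')$, or $\beta(b)=\beta(b')$ and $j(b)>j(b')$. An $e$-quasiperiod (quasiperiod) of $\mathcal{A}$ is a sequence of $e$ beads $(b_1,\dots,b_e)$ with $\beta(b_{i+1})=\beta(b_i)-1$ and $j(b_i)\ge j(b_{i+1})$ for $1\le i\le e-1$. Quasiperiods are ordered lexicographically. Fore periods. The first fore period $P_1$ of $\mathcal{A}$ is its largest quasiperiod; inductively the $k$'th fore period $P_k$ is the largest quasiperiod with $P_k<P_{k-1}$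 and $P_k\cap P_i=\emptyset$ for all $i<k$. Write $b_k^{(1)}>\dots>b_k^{(e)}$ for the beads of $P_k$. A bead in no fore period is a free bead. Vessels and aft periods. The $k$'th vessel $V_k$ of $\mathcal{A}$ is the union of $P_k$ and the set of free beads $b=(\beta,j)$ with $\beta(b_{k+1}^{(e)})\le\beta\le\beta(b_k^{(1)})$ satisfying (recursively in decreasing $\beta$): (i) if $\beta=\beta(b_k^{(i)})$ for some $i$ then $j>j(b_k^{(i)})$; (ii) if $\beta=\beta(b_{k+1}^{(i)})$ for some $i$ then $j<j(b_{k+1}^{(i)})$; (iii) if $\beta<\beta(b_k^{(e)})$ then there is $j'$ with $(\beta+1,j')\in V_k$. The $k$'th aft period $Q_k$ is the smallest quasiperiod contained in $V_k$. Shifts. A quasiperiod $P$ is right-shiftable if for each row $j$ that it meets, with $\beta_0=\max\{\beta\mid(\beta,j)\in P\}$, one has $(\beta_0+1,j)\notin\mathcal{A}$. Its right shift is $\tilde P=\{(\beta+1,j)\mid(\beta,j)\in P\}$, and shifting $P$ one unit to the right means replacing $\mathcal{A}$ by $(\mathcal{A}\setminus P)\cup\tilde P$. Left-shiftability, left shifts and shifting to the left are defined symmetrically. The $\mathfrak{sl}_\infty$-crystal. For a partition $\sigma=(\sigma_1\ge\sigma_2\ge\cdots)$, the operator $\tilde b_\sigma$ acts on $\ell$-abaci (preserving charge) by shifting the first fore period (of the current abacus) one unit to the right $\sigma_1$ times, then shifting the second fore period (of the current abacus) one unit to the right $\sigma_2$ times, and so on (these shifts are always defined). An abacus is a highest weight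 vertex for $\mathfrak{sl}_\infty$ if it is not of the form $\tilde b_\sigma\mathcal{B}$ with $\sigma\ne\emptyset$. It is known that every $\ell$-abacus is $\mathcal{A}=\tilde b_\theta\mathcal{A}^\circ$ for a unique partition $\theta$ and a unique highest weight vertex $\mathcal{A}^\circ$. The $\mathfrak{sl}_\infty$-crystal (for given $e$ and charge) is the directed graph on all $\ell$-abaci of that charge with an arrow $\tilde b_\theta\mathcal{A}^\circ\to\tilde b_\rho\mathcal{A}^\circ$, for each highest weight vertex $\mathcal{A}^\circ$, whenever $\rho$ is obtained from $\theta$ by adding one box. The operators $\Upsilon_k^{\pm}$. For $\mathcal{A}=\tilde b_\theta\mathcal{A}^\circ$ and $k\in\mathbb{N}$: $\Upsilon_k^+\mathcal{A}=\tilde b_\rho\mathcal{A}^\circ$ if adding a box to row $k$ of $\theta$ gives a partition $\rho$, and $\Upsilon_k^+\mathcal{A}=0$ otherwise; $\Upsilon_k^-\mathcal{A}=\tilde b_\rho\mathcal{A}^\circ$ if removing a box from row $k$ of $\theta$ gives a partition $\rho$, and $\Upsilon_k^-\mathcal{A}=0$ otherwise. *)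

theory Defs
  imports Main
begin

section \<open>Abaci, partitions and charges\<close>

text \<open>A position is a pair (column, row); rows are numbered from 1 (bottom) to l.\<close>

type_synonym bead = "int \<times> nat"

definition is_abacus :: "nat \<Rightarrow> bead set \<Rightarrow> bool" where
  "is_abacus l A \<longleftrightarrow> A \<subseteq> UNIV \<times> {1..l} \<and>
     (\<exists>m_minus m_plus. \<forall>j\<in>{1..l}.
        (\<forall>\<beta>\<le>m_minus. (\<beta>, j) \<in> A) \<and> (\<forall>\<beta>\<ge>m_plus. (\<beta>, j) \<notin> A))"

text \<open>Partitions are sequences of parts indexed from 1; the unused entry at index 0 is
  pinned to 0 so that each partition has exactly one representation. The empty
  partition is the constant function 0.\<close>

definition is_partition :: "(nat \<Rightarrow> nat) \<Rightarrow> bool" where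
  "is_partition \<sigma> \<longleftrightarrow>
     \<sigma> 0 = 0 \<and> (\<forall>i\<ge>1. \<sigma> (Suc i) \<le> \<sigma> i) \<and> finite {i. \<sigma> i \<noteq> 0}"

definition abacus_of :: "nat \<Rightarrow> (nat \<Rightarrow> nat \<Rightarrow> nat) \<Rightarrow> (nat \<Rightarrow> int) \<Rightarrow> bead set" where
  "abacus_of l lam s =
     {(int (lam j k) + s j - int k + 1, j) | j k. j \<in> {1..l} \<and> k \<ge> 1}"

definition has_charge :: "nat \<Rightarrow> bead set \<Rightarrow> (nat \<Rightarrow> int) \<Rightarrow> bool" where
  "has_charge l A s \<longleftrightarrow>
     (\<exists>lam. (\<forall>j\<in>{1..l}. is_partition (lam j)) \<and> A = abacus_of l lam s)"


section \<open>Quasiperiods and fore periods\<close>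

definition bead_order :: "(bead \<times> bead) set" where
  "bead_order = {(b, b'). fst b < fst b' \<or> (fst b = fst b' \<and> snd b > snd b')}"

definition quasiperiod :: "nat \<Rightarrow> bead set \<Rightarrow> bead list \<Rightarrow> bool" where
  "quasiperiod e A P \<longleftrightarrow> length P = e \<and> set P \<subseteq> A \<and>
     (\<forall>i. Suc i < e \<longrightarrow>
        fst (P ! Suc i) = fst (P ! i) - 1 \<and> snd (P ! i) \<ge> snd (P ! Suc i))"

definition qp_order :: "(bead list \<times> bead list) set" where
  "qp_order = lexord bead_order"

definition largest :: "bead list set \<Rightarrow> bead list" where
  "largest X = (THE P. P \<in> X \<and> (\<forall>P'\<in>X. P' \<noteq> P \<longrightarrow> (P', P) \<in> qp_order))"

definition smallest :: "bead list set \<Rightarrow> bead list" where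
  "smallest X = (THE P. P \<in> X \<and> (\<forall>P'\<in>X. P' \<noteq> P \<longrightarrow> (P, P') \<in> qp_order))"

text \<open>The index of fore periods, vessels and aft periods starts at 1; index 0 is junk.\<close>

fun fore_period :: "nat \<Rightarrow> bead set \<Rightarrow> nat \<Rightarrow> bead list" where
  "fore_period e A k = largest {P. quasiperiod e A P \<and>
     (1 < k \<longrightarrow> (P, fore_period e A (k - 1)) \<in> qp_order) \<and>
     (\<forall>i\<in>{1..<k}. set P \<inter> set (fore_period e A i) = {})}"

declare fore_period.simps [simp del]

definition free_beads :: "nat \<Rightarrow> bead set \<Rightarrow> bead set" where
  "free_beads e A = {b \<in> A. \<forall>k\<ge>1. b \<notin> set (fore_period e A k)}"


section \<open>Vessels and aft periods\<close>

text \<open>Membership of a column depends only (and positively) on membership of the column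
  to its right, and columns are bounded above, so the least fixed point is the set given
  by the recursion in decreasing column.\<close>

inductive_set vessel :: "nat \<Rightarrow> bead set \<Rightarrow> nat \<Rightarrow> bead set"
  for e :: nat and A :: "bead set" and k :: nat where
  period: "b \<in> set (fore_period e A k) \<Longrightarrow> b \<in> vessel e A k"
| free: "(\<beta>, j) \<in> free_beads e A \<Longrightarrow>
    fst (last (fore_period e A (k + 1))) \<le> \<beta> \<Longrightarrow>
    \<beta> \<le> fst (hd (fore_period e A k)) \<Longrightarrow>
    \<forall>c\<in>set (fore_period e A k). \<beta> = fst c \<longrightarrow> j > snd c \<Longrightarrow>
    \<forall>c\<in>set (fore_period e A (k + 1)). \<beta> = fst c \<longrightarrow> j < snd c \<Longrightarrow>
    \<beta> < fst (last (fore_period e A k)) \<longrightarrow> (\<exists>j'. (\<beta> + 1, j') \<in> vessel e A k) \<Longrightarrow>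
    (\<beta>, j) \<in> vessel e A k"

definition aft_period :: "nat \<Rightarrow> bead set \<Rightarrow> nat \<Rightarrow> bead list" where
  "aft_period e A k = smallest {Q. quasiperiod e A Q \<and> set Q \<subseteq> vessel e A k}"


section \<open>Shifts\<close>

definition move :: "int \<Rightarrow> bead list \<Rightarrow> bead list" where
  "move d P = map (\<lambda>(\<beta>, j). (\<beta> + d, j)) P"

definition right_shiftable :: "bead set \<Rightarrow> bead list \<Rightarrow> bool" where
  "right_shiftable A P \<longleftrightarrow>
     (\<forall>j \<in> snd ` set P. (Max {\<beta>. (\<beta>, j) \<in> set P} + 1, j) \<notin> A)"

definition left_shiftable :: "bead set \<Rightarrow> bead list \<Rightarrow> bool" where
  "left_shiftable A P \<longleftrightarrow>
     (\<forall>j \<in> snd ` set P. (Min {\<beta>. (\<beta>, j) \<in> set P} - 1, j) \<notin> A)"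

definition shift_right :: "bead set \<Rightarrow> bead list \<Rightarrow> bead set" where
  "shift_right A P = (A - set P) \<union> set (move 1 P)"

definition shift_left :: "bead set \<Rightarrow> bead list \<Rightarrow> bead set" where
  "shift_left A P = (A - set P) \<union> set (move (-1) P)"


section \<open>The crystal\<close>

text \<open>Rows 1, ..., n of \<open>\<sigma>\<close> are processed in this order, the fore period being recomputed
  for the current abacus at every single step. All these shifts are of right-shiftable
  periods when \<open>\<sigma>\<close> is a partition, so shiftability is not tested here.\<close>

primrec b_rows :: "nat \<Rightarrow> (nat \<Rightarrow> nat) \<Rightarrow> nat \<Rightarrow> bead set \<Rightarrow> bead set" where
  "b_rows e \<sigma> 0 A = A"
| "b_rows e \<sigma> (Suc n) A =
     ((\<lambda>B. shift_right B (fore_period e B (Suc n))) ^^ \<sigma> (Suc n)) (b_rows e \<sigma> n A)"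

text \<open>The number of nonzero entries of a partition is its number of rows.\<close>

definition b_op :: "nat \<Rightarrow> (nat \<Rightarrow> nat) \<Rightarrow> bead set \<Rightarrow> bead set" where
  "b_op e \<sigma> A = b_rows e \<sigma> (card {i. \<sigma> i \<noteq> 0}) A"

definition highest_weight :: "nat \<Rightarrow> nat \<Rightarrow> bead set \<Rightarrow> bool" where
  "highest_weight e l A \<longleftrightarrow> is_abacus l A \<and>
     \<not> (\<exists>\<sigma> B. is_partition \<sigma> \<and> \<sigma> \<noteq> (\<lambda>_. 0) \<and> is_abacus l B \<and> A = b_op e \<sigma> B)"

definition adds_box :: "nat \<Rightarrow> (nat \<Rightarrow> nat) \<Rightarrow> (nat \<Rightarrow> nat) \<Rightarrow> bool" where
  "adds_box k \<theta> \<rho> \<longleftrightarrow> k \<ge> 1 \<and> is_partition \<theta> \<and> is_partition \<rho> \<and> \<rho> = \<theta>(k := \<theta> k + 1)"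

definition crystal_arrows ::
    "nat \<Rightarrow> nat \<Rightarrow> (nat \<Rightarrow> int) \<Rightarrow> (bead set \<times> bead set) set" where
  "crystal_arrows e l s = {(A, A'). has_charge l A s \<and> has_charge l A' s \<and>
     (\<exists>H \<theta> \<rho>. highest_weight e l H \<and> (\<exists>k. adds_box k \<theta> \<rho>) \<and>
        A = b_op e \<theta> H \<and> A' = b_op e \<rho> H)}"

definition crystal_coords :: "nat \<Rightarrow> nat \<Rightarrow> bead set \<Rightarrow> (nat \<Rightarrow> nat) \<times> bead set" where
  "crystal_coords e l A =
     (THE (\<theta>, H). is_partition \<theta> \<and> highest_weight e l H \<and> A = b_op e \<theta> H)"

text \<open>The value 0 of the operators is rendered by \<open>None\<close>.\<close>

definition Upsilon_plus :: "nat \<Rightarrow> nat \<Rightarrow> nat \<Rightarrow> bead set \<Rightarrow> bead set option" where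
  "Upsilon_plus e l k A = (case crystal_coords e l A of (\<theta>, H) \<Rightarrow>
     if adds_box k \<theta> (\<theta>(k := \<theta> k + 1))
     then Some (b_op e (\<theta>(k := \<theta> k + 1)) H) else None)"

definition Upsilon_minus :: "nat \<Rightarrow> nat \<Rightarrow> nat \<Rightarrow> bead set \<Rightarrow> bead set option" where
  "Upsilon_minus e l k A = (case crystal_coords e l A of (\<theta>, H) \<Rightarrow>
     if adds_box k (\<theta>(k := \<theta> k - 1)) \<theta>
     then Some (b_op e (\<theta>(k := \<theta> k - 1)) H) else None)"


section \<open>The two descriptions of an arrow\<close>

definition downstream :: "nat \<Rightarrow> nat \<Rightarrow> bead set \<Rightarrow> bead set \<Rightarrow> bool" where
  "downstream e k A A' \<longleftrightarrow>
     right_shiftable A (fore_period e A k) \<and>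
     A' = shift_right A (fore_period e A k) \<and>
     move 1 (fore_period e A k) = aft_period e A' k"

definition upstream :: "nat \<Rightarrow> nat \<Rightarrow> bead set \<Rightarrow> bead set \<Rightarrow> bool" where
  "upstream e k A A' \<longleftrightarrow>
     left_shiftable A' (aft_period e A' k) \<and>
     A = shift_left A' (aft_period e A' k) \<and>
     move (-1) (aft_period e A' k) = fore_period e A k"

end

theory Submission
  imports Defs
begin

text \<open>Order quasiperiods by \<open>P \<preceq> Q\<close> when \<open>P\<close> starts weakly left of \<open>Q\<close> and runs weakly above it
  in every common column. The quasiperiods of a fixed bead set form a lattice under row-wise
  minimum and maximum, and the lexicographic order extends \<open>\<preceq>\<close>; so \<open>P\<^sub>k\<close> is the greatest
  quasiperiod of \<open>A - (P\<^sub>1 \<union> \<dots> \<union> P\<^sub>k\<^sub>-\<^sub>1)\<close>, and \<open>Q\<^sub>k\<close> is the least one of this set that lies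
  strictly right of \<open>P\<^sub>k\<^sub>+\<^sub>1\<close>.

  The key fact is that after replacing the greatest quasiperiod of a set by its right shift \<open>N\<close>,
  every quasiperiod is either \<open>\<succeq> N\<close> or strictly left of \<open>N\<close> (and dually for left shifts of the
  least one). It follows that an arrow with index \<open>k\<close> leaves \<open>A\<close> exactly if \<open>k = 1\<close> or the shift
  of \<open>P\<^sub>k\<close> is still strictly left of \<open>P\<^sub>k\<^sub>-\<^sub>1\<close>, that it changes no other fore period, and that an arrow
  with index \<open>k\<close> enters \<open>A\<close> exactly if one with index \<open>k + 1\<close> leaves it. These facts give the
  diamond property in both directions, and the graph is then identified with Young's lattice over
  each source by induction on the number of boxes.\<close>

section \<open>The lattice of quasiperiods\<close>

text \<open>The obstacle is that the right shift N of \<open>P\<^sub>k\<close> need not be the k-th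
  fore period \<open>P'\<^sub>k\<close> of the new abacus: free beads too low to be used before the
  shift may become usable, and then only N \<preceq> \<open>P'\<^sub>k\<close> holds. N is recovered
  at the other end of the vessel, as its least quasiperiod. Reversing an arrow therefore plays a
  greatest element against a least one, and both extremes are studied for arbitrary bead sets rather
  than for vessels. The connectivity clause of vessels is absorbed by the fact that no quasiperiod
  consists of free beads only. The decomposition into \<theta> and a highest weight vertex is itself
  proved here. Until the end, vertices without entering arrows replace highest weight vertices. The
  operator \<open>b_op\<close> adds boxes in one prescribed order, row by row; the two diamond
  properties make every other order available.\<close>

definition start :: "bead list \<Rightarrow> int" where
  "start P = fst (hd P)"

text \<open>Meaningful only for start P - e < c \<le> start P: further right \<open>nat\<close>
  truncates to the head of P, further left the index leaves the list. The formulas below restrict c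
  accordingly.\<close>

definition row_at :: "bead list \<Rightarrow> int \<Rightarrow> nat" where
  "row_at P c = snd (P ! nat (start P - c))"

locale chains =
  fixes e :: nat
  assumes e_pos: "0 < e"
begin

text \<open>Separating the shape of a quasiperiod from membership of its beads allows one chain to
  be compared across the bead sets before and after a shift.\<close>

abbreviation chain :: "bead list \<Rightarrow> bool" where
  "chain P \<equiv> quasiperiod e UNIV P"

definition path :: "int \<Rightarrow> (int \<Rightarrow> nat) \<Rightarrow> bead list" where
  "path s f = map (\<lambda>i. (s - int i, f (s - int i))) [0..<e]"

lemma quasiperiod_iff: "quasiperiod e A P \<longleftrightarrow> chain P \<and> set P \<subseteq> A"
  unfolding quasiperiod_def by auto

lemma chain_length: "chain P \<Longrightarrow> length P = e"
  by (simp add: quasiperiod_def)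

lemma chain_column:
  assumes "chain P" "i < e" shows "fst (P ! i) = start P - int i"
  using assms(2)
proof (induction i)
  case 0
  have "P \<noteq> []" using chain_length[OF assms(1)] e_pos by auto
  then show ?case by (simp add: start_def hd_conv_nth)
next
  case (Suc i)
  then show ?case using assms(1) by (simp add: quasiperiod_def)
qed

lemma chain_nth:
  assumes "chain P" "i < e" shows "P ! i = (start P - int i, row_at P (start P - int i))"
  using chain_column[OF assms] by (auto simp: row_at_def prod_eq_iff)

lemma chain_mem:
  assumes "chain P"
  shows "(c, r) \<in> set P \<longleftrightarrow> start P - int e < c \<and> c \<le> start P \<and> r = row_at P c"
proof
  assume "(c, r) \<in> set P"
  then obtain i where "i < e" "P ! i = (c, r)"
    using chain_length[OF assms] by (auto simp: in_set_conv_nth)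
  then show "start P - int e < c \<and> c \<le> start P \<and> r = row_at P c"
    using chain_nth[OF assms] by auto
next
  assume r: "start P - int e < c \<and> c \<le> start P \<and> r = row_at P c"
  then have i: "nat (start P - c) < e" by linarith
  then have "P ! nat (start P - c) = (c, r)"
    using chain_nth[OF assms i] r by simp
  then show "(c, r) \<in> set P"
    using i chain_length[OF assms] by (metis nth_mem)
qed

lemma chain_in:
  assumes "chain P" "start P - int e < c" "c \<le> start P"
  shows "(c, row_at P c) \<in> set P"
  using assms by (simp add: chain_mem)

lemma chain_subset_iff:
  assumes "chain P"
  shows "set P \<subseteq> A \<longleftrightarrow> (\<forall>c. start P - int e < c \<longrightarrow> c \<le> start P \<longrightarrow> (c, row_at P c) \<in> A)"
  using chain_mem[OF assms] by auto

lemma chain_step: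
  assumes "chain P" "start P - int e < c" "c < start P"
  shows "row_at P c \<le> row_at P (c + 1)"
proof -
  define i where "i = nat (start P - (c + 1))"
  have i: "Suc i < e" "start P - int i = c + 1" "start P - int (Suc i) = c"
    using assms by (auto simp: i_def)
  then show ?thesis
    using assms(1) chain_nth[OF assms(1), of i] chain_nth[OF assms(1), of "Suc i"]
    by (auto simp: quasiperiod_def)
qed

lemma chain_mono:
  assumes "chain P" "start P - int e < c" "c \<le> d" "d \<le> start P"
  shows "row_at P c \<le> row_at P d"
  using assms(3,4)
proof (induction d rule: int_ge_induct)
  case (step d)
  then show ?case using chain_step[OF assms(1), of d] assms(2) by fastforce
qed simp

lemma chain_eqI:
  assumes "chain P" "chain Q" "start P = start Q"
    and "\<And>c. start P - int e < c \<Longrightarrow> c \<le> start P \<Longrightarrow> row_at P c = row_at Q c"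
  shows "P = Q"
proof (rule nth_equalityI)
  show "length P = length Q" using assms by (simp add: chain_length)
  show "P ! i = Q ! i" if "i < length P" for i
    using that assms chain_nth[of P i] chain_nth[of Q i] by (simp add: chain_length)
qed

lemma start_path [simp]: "start (path s f) = s"
  using e_pos by (simp add: start_def path_def hd_map)

lemma row_at_path [simp]: "s - int e < c \<Longrightarrow> c \<le> s \<Longrightarrow> row_at (path s f) c = f c"
  using e_pos start_path[of s f] unfolding row_at_def by (simp add: path_def)

lemma chain_path:
  assumes "\<And>c. s - int e < c \<Longrightarrow> c < s \<Longrightarrow> f c \<le> f (c + 1)"
  shows "chain (path s f)"
  unfolding quasiperiod_def
proof (intro conjI allI impI)
  fix i assume i: "Suc i < e"
  show "fst (path s f ! Suc i) = fst (path s f ! i) - 1"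
    using i by (simp add: path_def)
  show "snd (path s f ! Suc i) \<le> snd (path s f ! i)"
    using i assms[of "s - int (Suc i)"] by (simp add: path_def)
qed (auto simp: path_def)

section \<open>Shifting chains\<close>

lemma start_move: "chain P \<Longrightarrow> start (move d P) = start P + d"
  using e_pos chain_length[of P] by (cases P) (auto simp: start_def move_def)

lemma chain_move: "chain P \<Longrightarrow> chain (move d P)"
  by (auto simp: quasiperiod_def move_def case_prod_beta)

lemma set_move: "(c, r) \<in> set (move d P) \<longleftrightarrow> (c - d, r) \<in> set P"
  by (force simp: move_def image_iff)

lemma move_move [simp]: "move d (move d' P) = move (d + d') P"
  by (auto simp: move_def)

lemma move_0 [simp]: "move 0 P = P"
  by (simp add: move_def)

lemma row_at_move:
  assumes "chain P" "start P + d - int e < c" "c \<le> start P + d"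
  shows "row_at (move d P) c = row_at P (c - d)"
  using chain_in[OF chain_move[OF assms(1)], of d c] assms
  by (simp add: set_move chain_mem start_move)

text \<open>Of two beads in one column the higher one is smaller, hence the reversed row inequality.
  Given start P \<le> start Q, the quantified columns are exactly the common ones; without any, the
  starts alone decide.\<close>

definition le :: "bead list \<Rightarrow> bead list \<Rightarrow> bool" (infix "\<preceq>" 50) where
  "P \<preceq> Q \<longleftrightarrow> start P \<le> start Q \<and>
     (\<forall>c. start Q - int e < c \<longrightarrow> c \<le> start P \<longrightarrow> row_at Q c \<le> row_at P c)"

definition lt :: "bead list \<Rightarrow> bead list \<Rightarrow> bool" (infix "\<lless>" 50) where
  "P \<lless> Q \<longleftrightarrow> start P \<le> start Q \<and>
     (\<forall>c. start Q - int e < c \<longrightarrow> c \<le> start P \<longrightarrow> row_at Q c < row_at P c)"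

lemma le_refl [simp]: "P \<preceq> P"
  by (simp add: le_def)

lemma lt_imp_le: "P \<lless> Q \<Longrightarrow> P \<preceq> Q"
  by (auto simp: le_def lt_def intro: less_imp_le)

text \<open>A common column of P and R is also a column of Q, because the start of Q lies between
  theirs. So vacuous comparisons do not break transitivity.\<close>

lemma le_trans: "P \<preceq> Q \<Longrightarrow> Q \<preceq> R \<Longrightarrow> P \<preceq> R"
  unfolding le_def by (smt (verit) le_trans)

lemma lt_le_trans: "P \<lless> Q \<Longrightarrow> Q \<preceq> R \<Longrightarrow> P \<lless> R"
  unfolding le_def lt_def by (smt (verit) le_less_trans)

lemma le_lt_trans: "P \<preceq> Q \<Longrightarrow> Q \<lless> R \<Longrightarrow> P \<lless> R"
  unfolding le_def lt_def by (smt (verit) less_le_trans)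

lemma lt_irrefl [simp]: "\<not> P \<lless> P"
  using e_pos unfolding lt_def by (auto intro!: exI[of _ "start P"])

lemma le_antisym:
  assumes "chain P" "chain Q" "P \<preceq> Q" "Q \<preceq> P" shows "P = Q"
  using assms unfolding le_def by (intro chain_eqI) (auto intro: le_antisym)

lemma lt_disjoint:
  assumes "chain P" "chain Q" "P \<lless> Q" shows "set P \<inter> set Q = {}"
  using assms by (fastforce simp: chain_mem lt_def)

lemma le_disjoint_imp_lt:
  assumes "chain P" "chain Q" "P \<preceq> Q" "set P \<inter> set Q = {}" shows "P \<lless> Q"
proof -
  have "row_at Q c < row_at P c" if "start Q - int e < c" "c \<le> start P" for c
  proof -
    have "row_at Q c \<noteq> row_at P c"
      using that assms chain_in[OF assms(1), of c] chain_in[OF assms(2), of c]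
      by (auto simp: le_def)
    then show ?thesis using assms(3) that by (fastforce simp: le_def)
  qed
  then show ?thesis using assms(3) by (simp add: lt_def le_def)
qed

lemma lt_move:
  assumes "chain P" "chain Q" "P \<lless> Q" shows "move d P \<lless> move d Q"
  using assms unfolding lt_def by (auto simp: start_move row_at_move)

text \<open>Rows weakly decrease to the left along a chain, so the shifted chain is weakly lower in
  every common column.\<close>

lemma le_move_right: "chain P \<Longrightarrow> P \<preceq> move 1 P"
  unfolding le_def using chain_mono[of P]
  by (auto simp: start_move row_at_move)

lemma le_move_left: "chain P \<Longrightarrow> move (-1) P \<preceq> P"
  using le_move_right[OF chain_move, of P "-1"] by simp

section \<open>Joins and meets of chains\<close>

definition join :: "bead list \<Rightarrow> bead list \<Rightarrow> bead list" where
  "join P Q = path (max (start P) (start Q)) (\<lambda>c.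
     if start P < c then row_at Q c else if start Q < c then row_at P c
     else min (row_at P c) (row_at Q c))"

definition meet :: "bead list \<Rightarrow> bead list \<Rightarrow> bead list" where
  "meet P Q = path (min (start P) (start Q)) (\<lambda>c.
     if c \<le> start P - int e then row_at Q c else if c \<le> start Q - int e then row_at P c
     else max (row_at P c) (row_at Q c))"

text \<open>The delicate column is the one where the chain starting further left begins: right of it
  only the other chain is used, and the minimum stays weakly below that chain.\<close>

lemma chain_join:
  assumes "chain P" "chain Q" shows "chain (join P Q)"
  unfolding join_def
proof (rule chain_path, goal_cases)
  case (1 c)
  have "row_at P c \<le> row_at P (c + 1)" if "c < start P"
    using chain_step[OF assms(1), of c] that 1 by linarith
  moreover have "row_at Q c \<le> row_at Q (c + 1)" if "c < start Q"
    using chain_step[OF assms(2), of c] that 1 by linarith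
  ultimately show ?case using 1 by (auto simp: min_def max_def split: if_splits)
qed

lemma chain_meet:
  assumes "chain P" "chain Q" shows "chain (meet P Q)"
  unfolding meet_def
proof (rule chain_path, goal_cases)
  case (1 c)
  have "row_at P c \<le> row_at P (c + 1)" if "start P - int e < c"
    using chain_step[OF assms(1), of c] that 1 by linarith
  moreover have "row_at Q c \<le> row_at Q (c + 1)" if "start Q - int e < c"
    using chain_step[OF assms(2), of c] that 1 by linarith
  ultimately show ?case using 1 by (auto simp: min_def max_def split: if_splits)
qed

lemma set_join:
  assumes "chain P" "chain Q" shows "set (join P Q) \<subseteq> set P \<union> set Q"
  unfolding chain_subset_iff[OF chain_join[OF assms]]
  by (auto simp: join_def chain_mem assms min_def)

lemma set_meet:
  assumes "chain P" "chain Q" shows "set (meet P Q) \<subseteq> set P \<union> set Q"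
  unfolding chain_subset_iff[OF chain_meet[OF assms]]
  by (auto simp: meet_def chain_mem assms max_def)

lemma le_join1: "chain P \<Longrightarrow> chain Q \<Longrightarrow> P \<preceq> join P Q"
  by (auto simp: join_def le_def)

lemma le_join2: "chain P \<Longrightarrow> chain Q \<Longrightarrow> Q \<preceq> join P Q"
  by (auto simp: join_def le_def)

lemma meet_le1: "chain P \<Longrightarrow> chain Q \<Longrightarrow> meet P Q \<preceq> P"
  by (auto simp: meet_def le_def)

lemma meet_le2: "chain P \<Longrightarrow> chain Q \<Longrightarrow> meet P Q \<preceq> Q"
  by (auto simp: meet_def le_def)

text \<open>If P started right of Q, the meet would use the bead of Q itself in the leftmost column
  of Q, where strictness fails. Elsewhere max(p, q) > q forces p > q. This extends results about
  chains \<preceq> Q to arbitrary chains.\<close>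

lemma meet_lt_imp_lt:
  assumes "chain P" "chain Q" "meet P Q \<lless> Q" shows "P \<lless> Q"
proof -
  have st: "start P \<le> start Q"
  proof (rule ccontr)
    assume "\<not> start P \<le> start Q"
    then show False using assms(3) e_pos
      unfolding lt_def meet_def by (auto dest!: spec[of _ "start Q - int e + 1"])
  qed
  then show ?thesis using assms(3) unfolding lt_def meet_def
    by (auto simp: less_max_iff_disj)
qed

section \<open>Comparison with the lexicographic order\<close>

lemma quasiperiodD:
  assumes "quasiperiod e A P" shows "chain P" "set P \<subseteq> A"
  using assms by (auto simp: quasiperiod_def)

lemma quasiperiodI: "chain P \<Longrightarrow> set P \<subseteq> A \<Longrightarrow> quasiperiod e A P"
  by (simp add: quasiperiod_def)

text \<open>At the first index where the chains differ, either the starts order the columns, or the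
  columns agree and the higher row is the smaller bead.\<close>

lemma le_imp_qp_order:
  assumes "chain P" "chain Q" "P \<preceq> Q" "P \<noteq> Q"
  shows "(P, Q) \<in> qp_order"
proof -
  have len: "length P = e" "length Q = e" using assms by (auto simp: chain_length)
  have "\<exists>i < e. P ! i \<noteq> Q ! i"
    using assms(4) len by (metis nth_equalityI)
  then obtain i where i: "i < e" "P ! i \<noteq> Q ! i" "\<And>j. j < i \<Longrightarrow> P ! j = Q ! j"
    using exists_least_iff[of "\<lambda>i. i < e \<and> P ! i \<noteq> Q ! i"] by (meson less_trans)
  have "(P ! i, Q ! i) \<in> bead_order"
  proof (cases "start P < start Q")
    case True
    then show ?thesis using assms i(1) by (simp add: bead_order_def chain_column)
  next
    case False
    then have s: "start P = start Q" using assms(3) by (simp add: le_def)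
    then have "row_at Q (start P - int i) \<le> row_at P (start P - int i)"
      using assms(3) i(1) by (auto simp: le_def)
    then show ?thesis using i s assms(1,2) by (auto simp: bead_order_def chain_nth)
  qed
  moreover have "take i P = take i Q"
    using i(1,3) len by (intro nth_equalityI) auto
  ultimately show ?thesis
    using i(1) len unfolding qp_order_def lexord_take_index_conv by auto
qed

lemma qp_order_asym: "(P, Q) \<in> qp_order \<Longrightarrow> (Q, P) \<notin> qp_order"
  unfolding qp_order_def
  by (rule lexord_asymmetric) (auto simp: asym_on_def bead_order_def)

lemma largest_eqI:
  assumes "\<And>C. C \<in> S \<Longrightarrow> chain C" "P \<in> S" "\<And>C. C \<in> S \<Longrightarrow> C \<preceq> P"
  shows "largest S = P"
  unfolding largest_def
proof (rule the_equality)
  show *: "P \<in> S \<and> (\<forall>P'\<in>S. P' \<noteq> P \<longrightarrow> (P', P) \<in> qp_order)"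
    by (auto intro!: le_imp_qp_order assms)
  fix T assume "T \<in> S \<and> (\<forall>P'\<in>S. P' \<noteq> T \<longrightarrow> (P', T) \<in> qp_order)"
  then show "T = P" using * qp_order_asym[of T P] by metis
qed

lemma smallest_eqI:
  assumes "\<And>C. C \<in> S \<Longrightarrow> chain C" "P \<in> S" "\<And>C. C \<in> S \<Longrightarrow> P \<preceq> C"
  shows "smallest S = P"
  unfolding smallest_def
proof (rule the_equality)
  show *: "P \<in> S \<and> (\<forall>P'\<in>S. P' \<noteq> P \<longrightarrow> (P, P') \<in> qp_order)"
    by (auto intro!: le_imp_qp_order assms)
  fix T assume "T \<in> S \<and> (\<forall>P'\<in>S. P' \<noteq> T \<longrightarrow> (T, P') \<in> qp_order)"
  then show "T = P" using * qp_order_asym[of T P] by metis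
qed

section \<open>Greatest and least quasiperiods\<close>

text \<open>Greatest for \<preceq>, hence stronger than lexicographically largest: it gives
  information in every column, not only at the first difference.\<close>

definition top :: "bead set \<Rightarrow> bead list \<Rightarrow> bool" where
  "top Y P \<longleftrightarrow> quasiperiod e Y P \<and> (\<forall>C. quasiperiod e Y C \<longrightarrow> C \<preceq> P)"

definition bottom :: "bead set \<Rightarrow> bead list \<Rightarrow> bool" where
  "bottom Y Q \<longleftrightarrow> quasiperiod e Y Q \<and> (\<forall>C. quasiperiod e Y C \<longrightarrow> Q \<preceq> C)"

lemma topD:
  assumes "top Y P" shows "chain P" "set P \<subseteq> Y" "\<And>C. chain C \<Longrightarrow> set C \<subseteq> Y \<Longrightarrow> C \<preceq> P"
  using assms unfolding top_def quasiperiod_iff[of Y] by auto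

lemma bottomD:
  assumes "bottom Y Q"
  shows "chain Q" "set Q \<subseteq> Y" "\<And>C. chain C \<Longrightarrow> set C \<subseteq> Y \<Longrightarrow> Q \<preceq> C"
  using assms unfolding bottom_def quasiperiod_iff[of Y] by auto

lemma topI:
  assumes "chain P" "set P \<subseteq> Y" "\<And>C. chain C \<Longrightarrow> set C \<subseteq> Y \<Longrightarrow> C \<preceq> P"
  shows "top Y P"
  using assms unfolding top_def by (auto intro: quasiperiodI dest: quasiperiodD)

lemma top_unique: "top Y P \<Longrightarrow> top Y P' \<Longrightarrow> P = P'"
  using le_antisym topD by metis

lemma exists_upper_bound:
  assumes "finite F" "F \<noteq> {}" "\<And>C. C \<in> F \<Longrightarrow> quasiperiod e Y C"
  shows "\<exists>T. quasiperiod e Y T \<and> (\<forall>C\<in>F. C \<preceq> T)"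
  using assms
proof (induction rule: finite_ne_induct)
  case (insert C F)
  then obtain T where T: "quasiperiod e Y T" "\<forall>C\<in>F. C \<preceq> T" by auto
  have C: "quasiperiod e Y C" using insert by auto
  note ch = quasiperiodD(1)[OF C] quasiperiodD(1)[OF T(1)]
  have "quasiperiod e Y (join C T)"
    using set_join[OF ch] chain_join[OF ch] quasiperiodD(2)[OF C] quasiperiodD(2)[OF T(1)]
    by (auto intro!: quasiperiodI)
  then show ?case using T(2) le_trans le_join1[OF ch] le_join2[OF ch]
    by (intro exI[of _ "join C T"]) auto
qed (auto intro: le_refl)

lemma exists_lower_bound:
  assumes "finite F" "F \<noteq> {}" "\<And>C. C \<in> F \<Longrightarrow> quasiperiod e Y C"
  shows "\<exists>T. quasiperiod e Y T \<and> (\<forall>C\<in>F. T \<preceq> C)"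
  using assms
proof (induction rule: finite_ne_induct)
  case (insert C F)
  then obtain T where T: "quasiperiod e Y T" "\<forall>C\<in>F. T \<preceq> C" by auto
  have C: "quasiperiod e Y C" using insert by auto
  note ch = quasiperiodD(1)[OF C] quasiperiodD(1)[OF T(1)]
  have "quasiperiod e Y (meet C T)"
    using set_meet[OF ch] chain_meet[OF ch] quasiperiodD(2)[OF C] quasiperiodD(2)[OF T(1)]
    by (auto intro!: quasiperiodI)
  then show ?case using T(2) le_trans meet_le1[OF ch] meet_le2[OF ch]
    by (intro exI[of _ "meet C T"]) auto
qed (auto intro: le_refl)

lemma finite_quasiperiods: "finite Y \<Longrightarrow> finite {C. quasiperiod e Y C}"
  by (rule finite_subset[OF _ finite_lists_length_eq[of Y e]])
    (auto simp: quasiperiod_def)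

lemma exists_bottom:
  assumes "finite Y" "quasiperiod e Y C" shows "\<exists>Q. bottom Y Q"
proof -
  have ne: "{D. quasiperiod e Y D} \<noteq> {}" using assms(2) by blast
  have "\<exists>T. quasiperiod e Y T \<and> (\<forall>D\<in>{D. quasiperiod e Y D}. T \<preceq> D)"
    by (intro exists_lower_bound finite_quasiperiods assms(1) ne) (erule CollectD)
  then show ?thesis by (simp add: bottom_def)
qed

text \<open>Y may be infinite to the left, but joining a competitor with the given C only moves it
  right, so all comparisons take place among the finitely many beads from column start C - e
  on.\<close>

lemma exists_top:
  assumes "\<And>m. finite {b \<in> Y. m \<le> fst b}" "quasiperiod e Y C" shows "\<exists>P. top Y P"
proof -
  define m where "m = start C - int e"
  define Z where "Z = {b \<in> Y. m \<le> fst b}"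
  note C = quasiperiodD[OF assms(2)]
  have "set C \<subseteq> Z"
    using C(2) chain_mem[OF C(1)] by (auto simp: Z_def m_def)
  then have "quasiperiod e Z C" using C(1) by (rule quasiperiodI[rotated])
  then have ne: "{D. quasiperiod e Z D} \<noteq> {}" by blast
  have "finite Z" using assms(1) by (simp add: Z_def)
  then have "\<exists>T. quasiperiod e Z T \<and> (\<forall>D\<in>{D. quasiperiod e Z D}. D \<preceq> T)"
    by (intro exists_upper_bound finite_quasiperiods ne) simp_all
  then obtain T where T: "quasiperiod e Z T" "\<And>D. quasiperiod e Z D \<Longrightarrow> D \<preceq> T"
    by (elim exE conjE) simp
  have "top Y T"
  proof (rule topI)
    show "chain T" "set T \<subseteq> Y" using quasiperiodD[OF T(1)] by (auto simp: Z_def)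
    fix D assume D: "chain D" "set D \<subseteq> Y"
    have J: "chain (join C D)" "C \<preceq> join C D" "D \<preceq> join C D"
      by (simp_all add: C D chain_join le_join1 le_join2)
    have "set (join C D) \<subseteq> Z"
    proof
      fix b assume b: "b \<in> set (join C D)"
      then have "start C - int e < fst b"
        using chain_mem[OF J(1), of "fst b" "snd b"] J(2) by (auto simp: le_def)
      then show "b \<in> Z" using b set_join[OF C(1) D(1)] C(2) D(2) by (auto simp: Z_def m_def)
    qed
    then have "join C D \<preceq> T" by (rule T(2)[OF quasiperiodI[OF J(1)]])
    then show "D \<preceq> T" by (rule le_trans[OF J(3)])
  qed
  then show ?thesis by blast
qed

text \<open>Exchange argument: a bead of Y strictly below P in column c, but not below the next bead
  of P to the left, could replace the bead of P there and give a quasiperiod that is not \<preceq>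
  P.\<close>

lemma top_lowest:
  assumes "top Y P" "(c, r) \<in> Y" "start P - int e < c" "c \<le> start P"
    and "start P - int e < c - 1 \<Longrightarrow> row_at P (c - 1) \<le> r"
  shows "row_at P c \<le> r"
proof (rule ccontr)
  assume less: "\<not> row_at P c \<le> r"
  note P = topD[OF assms(1)]
  let ?f = "(row_at P)(c := r)"
  have C: "chain (path (start P) ?f)"
  proof (rule chain_path)
    fix d assume d: "start P - int e < d" "d < start P"
    show "?f d \<le> ?f (d + 1)"
      using chain_step[OF P(1) d] assms(5) less d by (cases "d = c"; cases "d + 1 = c") auto
  qed
  moreover have "set (path (start P) ?f) \<subseteq> Y"
    unfolding chain_subset_iff[OF C] using P(2) assms(2) chain_in[OF P(1)] by auto
  ultimately have "path (start P) ?f \<preceq> P" using P(3) by blast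
  then show False using less assms(3,4) unfolding le_def
    by (auto dest!: spec[of _ c])
qed

text \<open>Otherwise the bead could be put in front of P and the last bead of P dropped, which
  gives a quasiperiod starting further right.\<close>

lemma top_no_extension:
  assumes "top Y P" "(start P + 1, r) \<in> Y" shows "r < row_at P (start P)"
proof (rule ccontr)
  assume less: "\<not> r < row_at P (start P)"
  note P = topD[OF assms(1)]
  let ?f = "(row_at P)(start P + 1 := r)"
  have C: "chain (path (start P + 1) ?f)"
    using chain_step[OF P(1)] less by (intro chain_path) (auto simp: not_less)
  moreover have "set (path (start P + 1) ?f) \<subseteq> Y"
    unfolding chain_subset_iff[OF C] using P(2) assms(2) chain_in[OF P(1)] by auto
  ultimately have "path (start P + 1) ?f \<preceq> P" using P(3) by blast
  then show False by (auto simp: le_def)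
qed

text \<open>Mirror image of the exchange for \<open>top\<close>: the bead now moves up, so the
  constraint comes from the column to the right.\<close>

lemma bottom_highest:
  assumes "bottom Y Q" "(c, r) \<in> Y" "start Q - int e < c" "c \<le> start Q"
    and "c < start Q \<Longrightarrow> r \<le> row_at Q (c + 1)"
  shows "r \<le> row_at Q c"
proof (rule ccontr)
  assume less: "\<not> r \<le> row_at Q c"
  note Q = bottomD[OF assms(1)]
  let ?f = "(row_at Q)(c := r)"
  have C: "chain (path (start Q) ?f)"
  proof (rule chain_path)
    fix d assume d: "start Q - int e < d" "d < start Q"
    show "?f d \<le> ?f (d + 1)"
      using chain_step[OF Q(1) d] assms(5) less d by (cases "d = c"; cases "d + 1 = c") auto
  qed
  moreover have "set (path (start Q) ?f) \<subseteq> Y"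
    unfolding chain_subset_iff[OF C] using Q(2) assms(2) chain_in[OF Q(1)] by auto
  ultimately have "Q \<preceq> path (start Q) ?f" using Q(3) by blast
  then show False using less assms(3,4) unfolding le_def
    by (auto dest!: spec[of _ c])
qed

lemma bottom_no_extension:
  assumes "bottom Y Q" "(start Q - int e, r) \<in> Y"
  shows "row_at Q (start Q - int e + 1) < r"
proof (rule ccontr)
  assume less: "\<not> row_at Q (start Q - int e + 1) < r"
  note Q = bottomD[OF assms(1)]
  let ?f = "(row_at Q)(start Q - int e := r)"
  have C: "chain (path (start Q - 1) ?f)"
    using chain_step[OF Q(1)] less by (intro chain_path) (auto simp: not_less)
  moreover have "set (path (start Q - 1) ?f) \<subseteq> Y"
    unfolding chain_subset_iff[OF C] using Q(2) assms(2) chain_in[OF Q(1)] by auto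
  ultimately have "Q \<preceq> path (start Q - 1) ?f" using Q(3) by blast
  then show False by (auto simp: le_def)
qed

text \<open>By the exchange argument, an old bead of C in a column of P lies strictly above P as
  soon as it is not below the bead of P to its left. The two cases separate chains starting in the
  new column start P + 1 from chains starting further left.\<close>

lemma le_shifted_top:
  assumes top: "top Y P" and C: "chain C" "set C \<subseteq> Y - set P \<union> set (move 1 P)"
    and le: "C \<preceq> move 1 P" and ne: "C \<noteq> move 1 P"
  shows "C \<lless> move 1 P"
proof -
  note P = topD[OF top]
  let ?N = "move 1 P"
  have N: "chain ?N" "start ?N = start P + 1" using P by (auto simp: chain_move start_move)
  have N_row: "row_at ?N c = row_at P (c - 1)" if "start P + 1 - int e < c" "c \<le> start P + 1" for c
    using that P by (simp add: row_at_move)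
  have sC: "start C \<le> start P + 1" using le N by (simp add: le_def)
  have free: "(c, row_at C c) \<in> Y - set P"
    if "start C - int e < c" "c \<le> start C" "start P + 1 - int e < c \<Longrightarrow> row_at C c \<noteq> row_at P (c - 1)" for c
  proof -
    have "(c, row_at C c) \<notin> set ?N"
      using that sC N_row chain_mem[OF N(1)] N(2) by auto
    then show ?thesis using C chain_in[OF C(1) that(1,2)] by blast
  qed
  have above: "row_at P c < row_at C c"
    if "(c, row_at C c) \<in> Y - set P" "start P - int e < c" "c \<le> start P"
      "start P - int e < c - 1 \<Longrightarrow> row_at P (c - 1) \<le> row_at C c" for c
  proof -
    have "row_at P c \<le> row_at C c" using top_lowest[OF top] that by blast
    moreover have "row_at P c \<noteq> row_at C c" using chain_in[OF P(1) that(2,3)] that(1) by auto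
    ultimately show ?thesis by simp
  qed
  \<comment> \<open>Once strictly above \<open>P\<close>, the chain stays above \<open>P\<close> going right, hence above
    its shift, and so consists of unmoved beads.\<close>
  have stay: "row_at P d < row_at C d"
    if "row_at P c < row_at C c" "start C - int e < c" "start P - int e < c" "c \<le> d"
      "d \<le> start C" "d \<le> start P" for c d
    using that(4,5,6)
  proof (induction d rule: int_ge_induct)
    case (step d)
    then have "row_at P d < row_at C (d + 1)"
      using chain_step[OF C(1), of d] that by fastforce
    moreover have "(d + 1, row_at C (d + 1)) \<in> Y - set P"
      using free[of "d + 1"] step that calculation by auto
    ultimately show ?case using above[of "d + 1"] step that by auto
  qed (use that in simp)
  have "row_at ?N c < row_at C c" if c: "start P + 1 - int e < c" "c \<le> start C" for c
  proof (cases "start C = start P + 1")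
    case True
    \<comment> \<open>If C left N anywhere, it would stay strictly above P from there to the right,
      and its first bead, an old one, would extend P.\<close>
    have eq: "row_at C d = row_at P (d - 1)" if d: "start P + 1 - int e < d" "d \<le> start P + 1" for d
    proof (rule ccontr)
      assume neq: "row_at C d \<noteq> row_at P (d - 1)"
      have gt: "row_at P (d - 1) < row_at C d"
        using neq le d N N_row True by (fastforce simp: le_def)
      have "row_at P (start P) < row_at C (start P + 1) \<and>
        (start P + 1, row_at C (start P + 1)) \<in> Y"
      proof (cases "d = start P + 1")
        case True
        then show ?thesis using gt free[of d] d neq \<open>start C = start P + 1\<close> by auto
      next
        case False
        then have "row_at P d < row_at C d"
          using above[of d] free[of d] d neq gt \<open>start C = start P + 1\<close> by auto
        then have "row_at P (start P) < row_at C (start P)"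
          using stay[of d "start P"] d False \<open>start C = start P + 1\<close> by auto
        then have "row_at P (start P) < row_at C (start P + 1)"
          using chain_step[OF C(1), of "start P"] d False \<open>start C = start P + 1\<close> by fastforce
        then show ?thesis using free[of "start P + 1"] d \<open>start C = start P + 1\<close> by auto
      qed
      then show False using top_no_extension[OF top] by fastforce
    qed
    have "C = ?N"
      using eq True N N_row C by (intro chain_eqI) auto
    then show ?thesis using ne by simp
  next
    case False
    \<comment> \<open>The leftmost column of P holds no bead of N, so C has an old bead there, and
      nothing to its left constrains the exchange.\<close>
    define a where "a = start P - int e + 1"
    have a: "start C - int e < a" "a \<le> start C" "start P - int e < a" "a \<le> start P"
      using c False sC e_pos by (auto simp: a_def)
    then have "row_at P a < row_at C a"
      using above[of a] free[of a] by (auto simp: a_def)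
    then have "row_at P (c - 1) < row_at C (c - 1)"
      using stay[of a "c - 1"] a c False sC by (auto simp: a_def)
    then have "row_at P (c - 1) < row_at C c"
      using chain_step[OF C(1), of "c - 1"] c False sC by fastforce
    then show ?thesis using N_row c sC by auto
  qed
  moreover have "start C \<le> start ?N" using sC N by simp
  ultimately show ?thesis unfolding lt_def N(2) by blast
qed

text \<open>The preceding lemma needs a chain \<preceq> N, so it is applied to the meet of C with N;
  strictness of the meet passes back to C.\<close>

lemma shifted_top_dichotomy:
  assumes "top Y P" "chain C" "set C \<subseteq> Y - set P \<union> set (move 1 P)"
  shows "move 1 P \<preceq> C \<or> C \<lless> move 1 P"
proof -
  have N: "chain (move 1 P)" using assms topD chain_move by blast
  let ?M = "meet C (move 1 P)"
  have M: "chain ?M" "?M \<preceq> C" "?M \<preceq> move 1 P" "set ?M \<subseteq> Y - set P \<union> set (move 1 P)"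
    using N assms chain_meet meet_le1 meet_le2 set_meet[OF assms(2) N] by blast+
  show ?thesis
  proof (cases "?M = move 1 P")
    case True
    then show ?thesis using M by simp
  next
    case False
    then show ?thesis using le_shifted_top[OF assms(1) M(1,4,3)] meet_lt_imp_lt[OF assms(2) N] by blast
  qed
qed

text \<open>Mirror image of \<open>le_shifted_top\<close>, following the chain from right to left:
  once strictly below Q, it stays strictly below.\<close>

lemma shifted_bottom_le:
  assumes bot: "bottom Y Q" and C: "chain C" "set C \<subseteq> Y - set Q \<union> set (move (-1) Q)"
    and le: "move (-1) Q \<preceq> C" and ne: "C \<noteq> move (-1) Q"
  shows "move (-1) Q \<lless> C"
proof -
  note Q = bottomD[OF bot]
  let ?N = "move (-1) Q"
  have N: "chain ?N" "start ?N = start Q - 1" using Q by (auto simp: chain_move start_move)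
  have N_row: "row_at ?N c = row_at Q (c + 1)" if "start Q - 1 - int e < c" "c \<le> start Q - 1" for c
    using that Q by (simp add: row_at_move)
  have sC: "start Q - 1 \<le> start C" using le N by (simp add: le_def)
  have free: "(c, row_at C c) \<in> Y - set Q"
    if "start C - int e < c" "c \<le> start C" "c < start Q \<Longrightarrow> row_at C c \<noteq> row_at Q (c + 1)" for c
  proof -
    have "(c, row_at C c) \<notin> set ?N"
      using that sC N_row chain_mem[OF N(1)] N(2) by auto
    then show ?thesis using C chain_in[OF C(1) that(1,2)] by blast
  qed
  have below: "row_at C c < row_at Q c"
    if "(c, row_at C c) \<in> Y - set Q" "start Q - int e < c" "c \<le> start Q"
      "c < start Q \<Longrightarrow> row_at C c \<le> row_at Q (c + 1)" for c
  proof -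
    have "row_at C c \<le> row_at Q c" using bottom_highest[OF bot] that by blast
    moreover have "row_at Q c \<noteq> row_at C c" using chain_in[OF Q(1) that(2,3)] that(1) by auto
    ultimately show ?thesis by simp
  qed
  have stay: "row_at C d < row_at Q d"
    if "row_at C c < row_at Q c" "c \<le> start C" "c \<le> start Q" "d \<le> c"
      "start C - int e < d" "start Q - int e < d" for c d
    using that(4,5,6)
  proof (induction d rule: int_le_induct)
    case (step d)
    then have "row_at C (d - 1) < row_at Q d"
      using chain_step[OF C(1), of "d - 1"] that by fastforce
    moreover have "(d - 1, row_at C (d - 1)) \<in> Y - set Q"
      using free[of "d - 1"] step that calculation by auto
    ultimately show ?case using below[of "d - 1"] step that by auto
  qed (use that in simp)
  have "row_at C c < row_at ?N c" if c: "start C - int e < c" "c \<le> start Q - 1" for c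
  proof (cases "start C = start Q - 1")
    case True
    have eq: "row_at C d = row_at Q (d + 1)" if d: "start C - int e < d" "d \<le> start C" for d
    proof (rule ccontr)
      assume neq: "row_at C d \<noteq> row_at Q (d + 1)"
      have gt: "row_at C d < row_at Q (d + 1)"
        using neq le d N N_row True by (fastforce simp: le_def)
      \<comment> \<open>The column just left of Q, into which the last bead of Q moves.\<close>
      define z where "z = start Q - int e"
      have "row_at C z < row_at Q (z + 1) \<and> (z, row_at C z) \<in> Y"
      proof (cases "d = z")
        case True
        then show ?thesis using gt free[of d] d neq \<open>start C = start Q - 1\<close> by auto
      next
        case False
        then have "row_at C d < row_at Q d"
          using below[of d] free[of d] d neq gt \<open>start C = start Q - 1\<close> by (auto simp: z_def)
        then have "row_at C (z + 1) < row_at Q (z + 1)"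
          using stay[of d "z + 1"] d False \<open>start C = start Q - 1\<close> by (auto simp: z_def)
        then have "row_at C z < row_at Q (z + 1)"
          using chain_step[OF C(1), of z] d False \<open>start C = start Q - 1\<close> by (fastforce simp: z_def)
        then show ?thesis using free[of z] d \<open>start C = start Q - 1\<close> by (auto simp: z_def)
      qed
      then show False using bottom_no_extension[OF bot] by (fastforce simp: z_def)
    qed
    have "C = ?N"
      using eq True N N_row C by (intro chain_eqI) auto
    then show ?thesis using ne by simp
  next
    case False
    \<comment> \<open>The rightmost column of Q is vacated by the left shift, so C has an old bead
      there.\<close>
    define a where "a = start Q"
    have a: "start C - int e < a" "a \<le> start C"
      using c False sC by (auto simp: a_def)
    then have "row_at C a < row_at Q a"
      using below[of a] free[of a] e_pos by (auto simp: a_def)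
    then have "row_at C (c + 1) < row_at Q (c + 1)"
      using stay[of a "c + 1"] a c False sC by (auto simp: a_def)
    then have "row_at C c < row_at Q (c + 1)"
      using chain_step[OF C(1), of c] c False sC by fastforce
    then show ?thesis using N_row c sC by auto
  qed
  moreover have "start ?N \<le> start C" using sC N by simp
  ultimately show ?thesis unfolding lt_def N(2) by blast
qed

text \<open>Encodes being strictly right of P as containment in a set of positions, so that least
  quasiperiods of bead sets can describe aft periods.\<close>

definition below :: "bead list \<Rightarrow> bead set" where
  "below P = {(c, r). start P < c \<or> start P - int e < c \<and> r < row_at P c}"

lemma subset_below_iff:
  assumes "chain C" shows "set C \<subseteq> below P \<longleftrightarrow> P \<lless> C"
proof
  assume sub: "set C \<subseteq> below P"
  have *: "start P < c \<or> start P - int e < c \<and> row_at C c < row_at P c"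
    if "start C - int e < c" "c \<le> start C" for c
    using sub chain_in[OF assms that] by (auto simp: below_def)
  show "P \<lless> C" unfolding lt_def
  proof (intro conjI allI impI)
    show "start P \<le> start C" using *[of "start C - int e + 1"] e_pos by auto
    show "row_at C c < row_at P c" if "start C - int e < c" "c \<le> start P" for c
      using *[OF that(1)] that \<open>start P \<le> start C\<close> by auto
  qed
next
  assume "P \<lless> C"
  then show "set C \<subseteq> below P"
    unfolding chain_subset_iff[OF assms] by (auto simp: below_def lt_def)
qed

text \<open>The join of T with a competitor lies strictly right of N, hence avoids N and consists of
  old beads; so it is \<preceq> T.\<close>

lemma top_insert_smaller:
  assumes "top X T" "set P \<inter> set T = {}" "chain N" "N \<lless> T"
  shows "top (X - set P \<union> set N) T"
proof (rule topI)
  note T = topD[OF assms(1)]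
  show "chain T" by (rule T)
  show "set T \<subseteq> X - set P \<union> set N" using T assms(2) by auto
  fix C assume C: "chain C" "set C \<subseteq> X - set P \<union> set N"
  have J: "chain (join C T)" "C \<preceq> join C T" "T \<preceq> join C T"
    by (simp_all add: C T chain_join le_join1 le_join2)
  have "set N \<inter> set (join C T) = {}"
    by (intro lt_disjoint lt_le_trans[OF assms(4)] assms J)
  then have "set (join C T) \<subseteq> X" using set_join[OF C(1) T(1)] C(2) T(2) by auto
  then show "C \<preceq> T" using T(3)[OF J(1)] le_trans[OF J(2)] by simp
qed

text \<open>Monotone rows make a chain meet each row in a block of consecutive columns. Only the
  last bead of a block moves to a position outside P, and this is the position tested by the
  maximum.\<close>

lemma right_shiftable_iff:
  assumes "chain P"
  shows "right_shiftable A P \<longleftrightarrow> set (move 1 P) \<inter> (A - set P) = {}"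
proof
  assume sh: "right_shiftable A P"
  show "set (move 1 P) \<inter> (A - set P) = {}"
  proof (rule ccontr)
    assume "set (move 1 P) \<inter> (A - set P) \<noteq> {}"
    then obtain c j where cj: "(c, j) \<in> set P" "(c + 1, j) \<in> A" "(c + 1, j) \<notin> set P"
      by (force simp: set_move)
    have fin: "finite {\<beta>. (\<beta>, j) \<in> set P}"
      by (rule finite_subset[of _ "fst ` set P"]) force+
    have "\<beta> \<le> c" if "(\<beta>, j) \<in> set P" for \<beta>
    proof (rule ccontr)
      assume "\<not> \<beta> \<le> c"
      then have "row_at P (c + 1) = j"
        using cj(1) that chain_mono[OF assms, of c "c + 1"] chain_mono[OF assms, of "c + 1" \<beta>]
        by (auto simp: chain_mem[OF assms])
      then show False using cj that \<open>\<not> \<beta> \<le> c\<close> by (auto simp: chain_mem[OF assms])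
    qed
    then have "Max {\<beta>. (\<beta>, j) \<in> set P} = c" using fin cj by (intro Max_eqI) auto
    then show False using sh cj by (force simp: right_shiftable_def)
  qed
next
  assume dis: "set (move 1 P) \<inter> (A - set P) = {}"
  show "right_shiftable A P" unfolding right_shiftable_def
  proof
    fix j assume "j \<in> snd ` set P"
    then have ne: "{\<beta>. (\<beta>, j) \<in> set P} \<noteq> {}" by force
    have fin: "finite {\<beta>. (\<beta>, j) \<in> set P}"
      by (rule finite_subset[of _ "fst ` set P"]) force+
    let ?m = "Max {\<beta>. (\<beta>, j) \<in> set P}"
    have "(?m, j) \<in> set P" using Max_in[OF fin ne] by simp
    moreover have "(?m + 1, j) \<notin> set P"
    proof
      assume "(?m + 1, j) \<in> set P"
      then have "?m + 1 \<le> ?m" by (intro Max_ge fin) simp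
      then show False by simp
    qed
    ultimately show "(?m + 1, j) \<notin> A" using dis by (auto simp: set_move disjoint_iff)
  qed
qed

lemma left_shiftable_iff:
  assumes "chain P"
  shows "left_shiftable A P \<longleftrightarrow> set (move (-1) P) \<inter> (A - set P) = {}"
proof
  assume sh: "left_shiftable A P"
  show "set (move (-1) P) \<inter> (A - set P) = {}"
  proof (rule ccontr)
    assume "set (move (-1) P) \<inter> (A - set P) \<noteq> {}"
    then obtain c j where cj: "(c, j) \<in> set P" "(c - 1, j) \<in> A" "(c - 1, j) \<notin> set P"
      by (force simp: set_move)
    have fin: "finite {\<beta>. (\<beta>, j) \<in> set P}"
      by (rule finite_subset[of _ "fst ` set P"]) force+
    have "c \<le> \<beta>" if "(\<beta>, j) \<in> set P" for \<beta>
    proof (rule ccontr)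
      assume "\<not> c \<le> \<beta>"
      then have "row_at P (c - 1) = j"
        using cj(1) that chain_mono[OF assms, of \<beta> "c - 1"] chain_mono[OF assms, of "c - 1" c]
        by (auto simp: chain_mem[OF assms])
      then show False using cj that \<open>\<not> c \<le> \<beta>\<close> by (auto simp: chain_mem[OF assms])
    qed
    then have "Min {\<beta>. (\<beta>, j) \<in> set P} = c" using fin cj by (intro Min_eqI) auto
    then show False using sh cj by (force simp: left_shiftable_def)
  qed
next
  assume dis: "set (move (-1) P) \<inter> (A - set P) = {}"
  show "left_shiftable A P" unfolding left_shiftable_def
  proof
    fix j assume "j \<in> snd ` set P"
    then have ne: "{\<beta>. (\<beta>, j) \<in> set P} \<noteq> {}" by force
    have fin: "finite {\<beta>. (\<beta>, j) \<in> set P}"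
      by (rule finite_subset[of _ "fst ` set P"]) force+
    let ?m = "Min {\<beta>. (\<beta>, j) \<in> set P}"
    have "(?m, j) \<in> set P" using Min_in[OF fin ne] by simp
    moreover have "(?m - 1, j) \<notin> set P"
    proof
      assume "(?m - 1, j) \<in> set P"
      then have "?m \<le> ?m - 1" by (intro Min_le fin) simp
      then show False by simp
    qed
    ultimately show "(?m - 1, j) \<notin> A" using dis by (auto simp: set_move disjoint_iff)
  qed
qed

lemma shifts_inverse:
  assumes "set P \<subseteq> A" "set (move d P) \<inter> (A - set P) = {}"
    and "A' = A - set P \<union> set (move d P)"
  shows "A = A' - set (move d P) \<union> set P" "set P \<inter> (A' - set (move d P)) = {}"
    "set (move d P) \<subseteq> A'"
  using assms by auto

end

section \<open>Abaci, fore periods and vessels\<close>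

lemma is_abacus_columns:
  assumes "is_abacus l A"
  obtains m M where "\<And>c j. c \<le> m \<Longrightarrow> j \<in> {1..l} \<Longrightarrow> (c, j) \<in> A"
    "\<And>c j. (c, j) \<in> A \<Longrightarrow> c < M \<and> j \<in> {1..l}"
proof -
  obtain m M where mM: "\<And>j. j \<in> {1..l} \<Longrightarrow>
      (\<forall>c\<le>m. (c, j) \<in> A) \<and> (\<forall>c\<ge>M. (c, j) \<notin> A)"
    and sub: "A \<subseteq> UNIV \<times> {1..l}" using assms unfolding is_abacus_def by blast
  show thesis
  proof
    show "(c, j) \<in> A" if "c \<le> m" "j \<in> {1..l}" for c j using mM that by blast
    show "c < M \<and> j \<in> {1..l}" if "(c, j) \<in> A" for c j
      using mM sub that by (metis SigmaD2 linorder_not_le subsetD)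
  qed
qed

lemma is_abacusI:
  assumes "\<And>c j. c \<le> m \<Longrightarrow> j \<in> {1..l} \<Longrightarrow> (c, j) \<in> A"
    "\<And>c j. (c, j) \<in> A \<Longrightarrow> c < M \<and> j \<in> {1..l}"
  shows "is_abacus l A"
  unfolding is_abacus_def
proof (intro conjI exI ballI allI impI)
  show "A \<subseteq> UNIV \<times> {1..l}" using assms(2) by auto
  show "(c, j) \<in> A" if "j \<in> {1..l}" "c \<le> m" for j c using that assms(1) by blast
  show "(c, j) \<notin> A" if "j \<in> {1..l}" "M \<le> c" for j c using that assms(2)[of c j] by auto
qed

lemma is_abacus_finite:
  assumes "is_abacus l A" shows "finite {b \<in> A. m \<le> fst b}"
proof -
  obtain M where "\<And>c j. (c, j) \<in> A \<Longrightarrow> c < M \<and> j \<in> {1..l}"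
    using is_abacus_columns[OF assms] by metis
  then have "{b \<in> A. m \<le> fst b} \<subseteq> {m..<M} \<times> {1..l}" by force
  then show ?thesis by (rule finite_subset) simp
qed

lemma is_abacus_replace:
  assumes "is_abacus l A" "set P \<subseteq> A"
  shows "is_abacus l (A - set P \<union> set (move d P))"
proof -
  obtain m M where mM: "\<And>c j. c \<le> m \<Longrightarrow> j \<in> {1..l} \<Longrightarrow> (c, j) \<in> A"
    "\<And>c j. (c, j) \<in> A \<Longrightarrow> c < M \<and> j \<in> {1..l}" by (rule is_abacus_columns[OF assms(1)]) blast
  define m' where "m' = Min (insert m (fst ` set P)) - 1"
  have m': "m' < m" "\<And>c j. (c, j) \<in> set P \<Longrightarrow> m' < c"
  proof -
    have *: "Min (insert m (fst ` set P)) \<le> c" if "c = m \<or> c \<in> fst ` set P" for c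
      using that by (intro Min_le) auto
    from this[of m] show "m' < m" unfolding m'_def by linarith
    fix c j assume "(c, j) \<in> set P"
    then have "c \<in> fst ` set P" by force
    with *[of c] show "m' < c" unfolding m'_def by linarith
  qed
  show ?thesis
  proof (rule is_abacusI[where m = m' and M = "M + \<bar>d\<bar>"])
    show "(c, j) \<in> A - set P \<union> set (move d P)" if "c \<le> m'" "j \<in> {1..l}" for c j
      using that mM(1)[of c j] m'(1) m'(2)[of c j] by auto
    fix c j assume "(c, j) \<in> A - set P \<union> set (move d P)"
    then have "(c, j) \<in> A \<or> (c - d, j) \<in> A"
      using assms(2) by (force simp: move_def)
    then show "c < M + \<bar>d\<bar> \<and> j \<in> {1..l}" using mM(2) by fastforce
  qed
qed

locale abaci = chains +
  fixes l :: nat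
  assumes l_pos: "0 < l"
begin

definition rest :: "bead set \<Rightarrow> nat \<Rightarrow> bead set" where
  "rest A k = A - (\<Union>i\<in>{1..<k}. set (fore_period e A i))"

lemma rest_antimono: "i \<le> k \<Longrightarrow> rest A k \<subseteq> rest A i"
  unfolding rest_def by auto

text \<open>Far enough to the left all rows are full, so row 1 supplies e consecutive beads avoiding
  F. Hence the sequence of fore periods never stops.\<close>

lemma exists_top_cofinite:
  assumes "is_abacus l A" "finite F" shows "\<exists>P. top (A - F) P"
proof -
  obtain m where m: "\<And>c j. c \<le> m \<Longrightarrow> j \<in> {1..l} \<Longrightarrow> (c, j) \<in> A"
    using is_abacus_columns[OF assms(1)] by metis
  define s where "s = Min (insert m (fst ` F)) - 1"
  have fin: "finite (insert m (fst ` F))" using assms(2) by simp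
  have s: "s < c" if "c \<in> insert m (fst ` F)" for c
    using Min_le[OF fin that] by (simp add: s_def)
  have C: "chain (path s (\<lambda>_. 1))" by (rule chain_path) simp
  have "set (path s (\<lambda>_. 1)) \<subseteq> A - F"
    unfolding chain_subset_iff[OF C]
  proof (intro allI impI)
    fix c assume c: "start (path s (\<lambda>_. 1)) - int e < c" "c \<le> start (path s (\<lambda>_. 1))"
    have "(c, 1) \<notin> F"
    proof
      assume "(c, 1) \<in> F"
      then have "s < c" by (intro s) force
      then show False using c by simp
    qed
    moreover have "(c, 1) \<in> A" using m[of c 1] s[of m] c l_pos by simp
    ultimately show "(c, row_at (path s (\<lambda>_. 1)) c) \<in> A - F" using c by simp
  qed
  then have "quasiperiod e (A - F) (path s (\<lambda>_. 1))" by (rule quasiperiodI[OF C])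
  moreover have "finite {b \<in> A - F. m \<le> fst b}" for m
    by (rule finite_subset[OF _ is_abacus_finite[OF assms(1)]]) auto
  ultimately show ?thesis by (rule exists_top[rotated])
qed

lemma chain_inter_self: "chain P \<Longrightarrow> set P \<inter> set P = {} \<Longrightarrow> False"
  using chain_in[of P "start P"] e_pos by auto

text \<open>A quasiperiod of the remaining beads also competes for index k - 1, so it is \<preceq>
  the previous fore period, and disjointness excludes equality. This yields the order condition of
  the recursion.\<close>

lemma fore_top:
  assumes "is_abacus l A" "1 \<le> k" shows "top (rest A k) (fore_period e A k)"
  using assms(2)
proof (induction k rule: less_induct)
  case (less k)
  obtain T where T: "top (rest A k) T"
    using exists_top_cofinite[OF assms(1)] unfolding rest_def by (metis finite_UN_I finite_atLeastLessThan List.finite_set)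
  let ?S = "{P. quasiperiod e A P \<and>
     (1 < k \<longrightarrow> (P, fore_period e A (k - 1)) \<in> qp_order) \<and>
     (\<forall>i\<in>{1..<k}. set P \<inter> set (fore_period e A i) = {})}"
  note TD = topD[OF T]
  have "largest ?S = T"
  proof (rule largest_eqI)
    show "chain C" if "C \<in> ?S" for C using that quasiperiodD(1) by auto
    show "C \<preceq> T" if "C \<in> ?S" for C
      using that quasiperiodD[of A C] by (intro TD(3)) (auto simp: rest_def)
    have "(T, fore_period e A (k - 1)) \<in> qp_order" if "1 < k"
    proof -
      have top: "top (rest A (k - 1)) (fore_period e A (k - 1))"
        using that less by auto
      have "set T \<inter> set (fore_period e A (k - 1)) = {}"
        using that TD(2) by (auto simp: rest_def)
      then have "T \<noteq> fore_period e A (k - 1)" using chain_inter_self[OF TD(1)] by auto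
      moreover have "T \<preceq> fore_period e A (k - 1)"
        using TD rest_antimono[of "k - 1" k A] by (intro topD(3)[OF top]) auto
      ultimately show ?thesis using TD(1) topD(1)[OF top] by (intro le_imp_qp_order)
    qed
    then show "T \<in> ?S"
      using TD by (auto simp: rest_def intro!: quasiperiodI)
  qed
  then show ?case using T by (simp add: fore_period.simps[of e A k])
qed

lemmas fore_chain = topD(1)[OF fore_top]
lemmas fore_subset_rest = topD(2)[OF fore_top]
lemmas fore_greatest = topD(3)[OF fore_top]

lemma fore_subset: "is_abacus l A \<Longrightarrow> 1 \<le> k \<Longrightarrow> set (fore_period e A k) \<subseteq> A"
  using fore_subset_rest by (auto simp: rest_def)

lemma fore_lt:
  assumes "is_abacus l A" "1 \<le> i" "i < j"
  shows "fore_period e A j \<lless> fore_period e A i"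
proof -
  have j: "1 \<le> j" using assms by simp
  have "fore_period e A j \<preceq> fore_period e A i"
    using fore_subset_rest[OF assms(1) j] rest_antimono[of i j A] assms(3)
    by (intro fore_greatest[OF assms(1,2) fore_chain[OF assms(1) j]]) auto
  moreover have "set (fore_period e A j) \<inter> set (fore_period e A i) = {}"
    using fore_subset_rest[OF assms(1) j] assms by (auto simp: rest_def)
  ultimately show ?thesis
    by (intro le_disjoint_imp_lt fore_chain assms j)
qed

lemma fore_le:
  assumes "is_abacus l A" "1 \<le> i" "i \<le> j"
  shows "fore_period e A j \<preceq> fore_period e A i"
  using fore_lt[OF assms(1,2)] assms(3) lt_imp_le by (cases "i = j") auto

lemma fore_eqI:
  assumes "is_abacus l A"
    and "\<And>i. 1 \<le> i \<Longrightarrow> i \<le> n \<Longrightarrow> top (A - (\<Union>j\<in>{1..<i}. set (R j))) (R i)"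
    and "1 \<le> i" "i \<le> n"
  shows "fore_period e A i = R i"
  using assms(3,4)
proof (induction i rule: less_induct)
  case (less i)
  then have "(\<Union>j\<in>{1..<i}. set (R j)) = (\<Union>j\<in>{1..<i}. set (fore_period e A j))" by auto
  then have "top (rest A i) (R i)" using assms(2) less by (simp add: rest_def)
  then show ?case using top_unique fore_top[OF assms(1)] less by blast
qed

text \<open>Every fore period would be \<succeq> C, so infinitely many disjoint fore periods would
  start weakly right of the start of C, where there are only finitely many beads.\<close>

lemma no_chain_of_free_beads:
  assumes "is_abacus l A" "chain C" shows "\<not> set C \<subseteq> free_beads e A"
proof
  assume sub: "set C \<subseteq> free_beads e A"
  have le: "C \<preceq> fore_period e A k" if "1 \<le> k" for k
    using sub that by (intro fore_greatest[OF assms(1) that assms(2)]) (auto simp: rest_def free_beads_def)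
  define b where "b k = (start (fore_period e A k), row_at (fore_period e A k) (start (fore_period e A k)))" for k
  have b: "b k \<in> set (fore_period e A k)" if "1 \<le> k" for k
    unfolding b_def using that e_pos by (intro chain_in fore_chain[OF assms(1)]) auto
  have "b i \<noteq> b j" if "1 \<le> i" "i < j" for i j
    using lt_disjoint[OF fore_chain fore_chain fore_lt[OF assms(1) that]] assms(1) that b[of i] b[of j]
    by auto
  then have "inj_on b {1..}" by (intro linorder_inj_onI) auto
  moreover have "b ` {1..} \<subseteq> {b \<in> A. start C \<le> fst b}"
  proof
    fix x assume "x \<in> b ` {1..}"
    then obtain k where k: "1 \<le> k" "x = b k" by auto
    then show "x \<in> {b \<in> A. start C \<le> fst b}"
      using b[OF k(1)] le[OF k(1)] fore_subset[OF assms(1) k(1)] by (auto simp: b_def le_def)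
  qed
  then have "finite (b ` {1..})" using is_abacus_finite[OF assms(1)] finite_subset by blast
  ultimately have "finite {(1::nat)..}" using finite_imageD by blast
  then show False using infinite_Ici by blast
qed

section \<open>Vessels and aft periods through consecutive fore periods\<close>

lemma last_column: "chain P \<Longrightarrow> fst (last P) = start P - int e + 1"
  using chain_length[of P] chain_column[of P "e - 1"] e_pos
  by (cases "P = []") (auto simp: last_conv_nth of_nat_diff)

lemma vessel_subset:
  assumes "is_abacus l A" "1 \<le> k"
  shows "vessel e A k \<subseteq> rest A k \<inter> below (fore_period e A (k + 1))"
proof
  let ?q = "fore_period e A (k + 1)"
  have q: "chain ?q" using assms by (intro fore_chain) auto
  fix b assume "b \<in> vessel e A k"
  then show "b \<in> rest A k \<inter> below ?q"
  proof cases
    case period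
    then show ?thesis
      using fore_subset_rest[OF assms] subset_below_iff[OF fore_chain[OF assms]] fore_lt[OF assms, of "k + 1"]
      by auto
  next
    case (free c j)
    have "j < row_at ?q c" if "c \<le> start ?q"
    proof -
      have "(c, row_at ?q c) \<in> set ?q"
        using that free(3) last_column[OF q] by (intro chain_in[OF q]) auto
      then show ?thesis using free(6) by force
    qed
    then have "(c, j) \<in> below ?q" using free(3) last_column[OF q]
      by (cases "c \<le> start ?q") (auto simp: below_def)
    then show ?thesis using free(1,2) by (auto simp: rest_def free_beads_def)
  qed
qed

text \<open>The recursive clause of the vessel asks for an unbroken run of columns from the fore
  period leftwards. A chain provides it: it cannot consist of free beads only, so it starts within
  the columns of the fore period, and it proceeds one column at a time.\<close>

lemma subset_vessel_iff:
  assumes "is_abacus l A" "1 \<le> k" "chain C"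
  shows "set C \<subseteq> vessel e A k \<longleftrightarrow> set C \<subseteq> rest A k \<inter> below (fore_period e A (k + 1))"
proof
  assume "set C \<subseteq> vessel e A k"
  then show "set C \<subseteq> rest A k \<inter> below (fore_period e A (k + 1))"
    using vessel_subset[OF assms(1,2)] by blast
next
  let ?p = "fore_period e A k" and ?q = "fore_period e A (k + 1)"
  have p: "chain ?p" and q: "chain ?q" using assms by (auto intro: fore_chain)
  assume C: "set C \<subseteq> rest A k \<inter> below ?q"
  then have qC: "?q \<lless> C" using subset_below_iff[OF assms(3)] by auto
  have Cp: "C \<preceq> ?p" using C by (intro fore_greatest assms) auto
  have free_or: "b \<in> set ?p \<or> b \<in> free_beads e A" if "b \<in> set C" for b
  proof -
    \<comment> \<open>Earlier fore periods are excluded by \<open>rest\<close>; later ones are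
      \<preceq> the one with index k + 1 and hence strictly left of C.\<close>
    have "b \<notin> set (fore_period e A i)" if "1 \<le> i" "i \<noteq> k" for i
    proof (cases "i < k")
      case True
      then show ?thesis using C \<open>b \<in> set C\<close> that by (auto simp: rest_def)
    next
      case False
      then have "fore_period e A i \<lless> C"
        using fore_le[OF assms(1), of "k + 1" i] that qC le_lt_trans by auto
      then show ?thesis using lt_disjoint[OF fore_chain[OF assms(1) that(1)] assms(3)] \<open>b \<in> set C\<close> by blast
    qed
    then show ?thesis using C \<open>b \<in> set C\<close> by (force simp: free_beads_def rest_def)
  qed
  have start_C: "start ?p - int e < start C"
  proof (rule ccontr)
    assume "\<not> start ?p - int e < start C"
    then have "set C \<inter> set ?p = {}" using chain_mem[OF assms(3)] chain_mem[OF p] by auto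
    then have "set C \<subseteq> free_beads e A" using free_or by blast
    then show False using no_chain_of_free_beads[OF assms(1,3)] by blast
  qed
  have in_vessel: "(c, row_at C c) \<in> vessel e A k"
    if "start C - int e < c" "c \<le> start C"
      and right: "c < start ?p - int e + 1 \<longrightarrow> (\<exists>j'. (c + 1, j') \<in> vessel e A k)" for c
  proof (cases "(c, row_at C c) \<in> set ?p")
    case False
    have mem: "(c, row_at C c) \<in> set C" by (rule chain_in[OF assms(3) that(1,2)])
    show ?thesis
    proof (rule vessel.free)
      show "(c, row_at C c) \<in> free_beads e A" using free_or[OF mem] False by blast
      show "fst (last ?q) \<le> c" using qC that last_column[OF q] by (simp add: lt_def)
      show "c \<le> fst (hd ?p)" using Cp that by (simp add: le_def start_def)
      show "\<forall>b\<in>set ?p. c = fst b \<longrightarrow> snd b < row_at C c"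
      proof (intro ballI impI)
        fix b assume b: "b \<in> set ?p" "c = fst b"
        then have "start ?p - int e < c" "snd b = row_at ?p c"
          using chain_mem[OF p, of "fst b" "snd b"] by auto
        then show "snd b < row_at C c"
          using Cp that False b by (cases b) (force simp: le_def nat_less_le)
      qed
      show "\<forall>b\<in>set ?q. c = fst b \<longrightarrow> row_at C c < snd b"
      proof (intro ballI impI)
        fix b assume b: "b \<in> set ?q" "c = fst b"
        then have "c \<le> start ?q" "snd b = row_at ?q c"
          using chain_mem[OF q, of "fst b" "snd b"] by auto
        then show "row_at C c < snd b" using qC that by (simp add: lt_def)
      qed
      show "c < fst (last ?p) \<longrightarrow> (\<exists>j'. (c + 1, j') \<in> vessel e A k)"
        using right last_column[OF p] by simp
    qed
  qed (rule vessel.period)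
  have "(c, row_at C c) \<in> vessel e A k" if "c \<le> start C" "start C - int e < c" for c
    using that
  proof (induction c rule: int_le_induct)
    case base
    then show ?case using start_C by (intro in_vessel) auto
  next
    case (step c)
    then show ?case using in_vessel[of "c - 1"] by fastforce
  qed
  then show "set C \<subseteq> vessel e A k" unfolding chain_subset_iff[OF assms(3)] by blast
qed

lemma aft_bottom:
  assumes "is_abacus l A" "1 \<le> k"
  shows "bottom (rest A k \<inter> below (fore_period e A (k + 1))) (aft_period e A k)"
proof -
  let ?q = "fore_period e A (k + 1)" and ?p = "fore_period e A k"
  let ?Y = "rest A k \<inter> below ?q"
  have "finite ?Y"
    by (rule finite_subset[OF _ is_abacus_finite[OF assms(1), of "start ?q - int e"]])
      (auto simp: rest_def below_def)
  moreover have p: "quasiperiod e ?Y ?p"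
    using fore_subset_rest[OF assms] fore_lt[OF assms, of "k + 1"]
      subset_below_iff[OF fore_chain[OF assms]]
    by (intro quasiperiodI[OF fore_chain[OF assms]]) auto
  ultimately obtain Q where Q: "bottom ?Y Q" using exists_bottom by blast
  have "{Q. quasiperiod e A Q \<and> set Q \<subseteq> vessel e A k} = {Q. quasiperiod e ?Y Q}"
    (is "?L = ?R")
  proof (intro Collect_cong iffI)
    fix C assume C: "quasiperiod e A C \<and> set C \<subseteq> vessel e A k"
    then have "chain C" using quasiperiodD(1) by blast
    then show "quasiperiod e ?Y C"
      using C subset_vessel_iff[OF assms \<open>chain C\<close>] by (intro quasiperiodI[OF \<open>chain C\<close>]) auto
  next
    fix C assume C: "quasiperiod e ?Y C"
    note ch = quasiperiodD[OF C]
    have "quasiperiod e A C" using ch by (intro quasiperiodI[OF ch(1)]) (auto simp: rest_def)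
    then show "quasiperiod e A C \<and> set C \<subseteq> vessel e A k"
      using subset_vessel_iff[OF assms ch(1)] ch(2) by blast
  qed
  moreover have "smallest {Q. quasiperiod e ?Y Q} = Q"
  proof (rule smallest_eqI)
    show "chain C" if "C \<in> {Q. quasiperiod e ?Y Q}" for C
      using that quasiperiodD(1)[of ?Y C] by simp
    show "Q \<in> {Q. quasiperiod e ?Y Q}" "\<And>C. C \<in> {Q. quasiperiod e ?Y Q} \<Longrightarrow> Q \<preceq> C"
      using Q by (auto simp: bottom_def)
  qed
  ultimately show ?thesis using Q by (simp add: aft_period_def)
qed

lemma aft_eqI:
  assumes "is_abacus l A" "1 \<le> k" "chain Q"
    and "set Q \<subseteq> rest A k" "fore_period e A (k + 1) \<lless> Q"
    and "\<And>C. chain C \<Longrightarrow> set C \<subseteq> rest A k \<Longrightarrow> fore_period e A (k + 1) \<lless> C \<Longrightarrow> Q \<preceq> C"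
  shows "aft_period e A k = Q"
proof -
  note B = bottomD[OF aft_bottom[OF assms(1,2)]]
  show ?thesis
  proof (rule le_antisym)
    show "aft_period e A k \<preceq> Q" using assms(3-5) by (intro B(3)) (auto simp: subset_below_iff)
    have "fore_period e A (k + 1) \<lless> aft_period e A k"
      using subset_below_iff[OF B(1)] B(2) by blast
    then show "Q \<preceq> aft_period e A k" using B(1,2) by (intro assms(6)) blast+
    show "chain (aft_period e A k)" by (rule B)
    show "chain Q" by (rule assms)
  qed
qed

section \<open>Moving a single period\<close>

text \<open>Stated for an arbitrary replacement of P by N, since it serves right shifts of fore
  periods, left shifts of aft periods, and shifts not known to be movable.\<close>

lemma fore_unchanged_smaller:
  assumes "is_abacus l A" "is_abacus l A'" "A' = A - set P \<union> set N" "chain N"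
    and "\<And>j. 1 \<le> j \<Longrightarrow> j < k \<Longrightarrow> N \<lless> fore_period e A j"
    and "\<And>j. 1 \<le> j \<Longrightarrow> j < k \<Longrightarrow> set P \<inter> set (fore_period e A j) = {}"
  shows "1 \<le> i \<Longrightarrow> i < k \<Longrightarrow> fore_period e A' i = fore_period e A i"
    and "i \<le> k \<Longrightarrow> rest A' i = rest A i - set P \<union> set N"
proof -
  have dis: "set N \<inter> set (fore_period e A j) = {}" if "1 \<le> j" "j < k" for j
    using that by (intro lt_disjoint fore_chain assms)
  have rest_eq: "A' - (\<Union>j\<in>{1..<i}. set (fore_period e A j)) = rest A i - set P \<union> set N"
    if "i \<le> k" for i
  proof -
    have "set N \<inter> (\<Union>j\<in>{1..<i}. set (fore_period e A j)) = {}" using dis that by fastforce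
    then show ?thesis unfolding rest_def assms(3) by blast
  qed
  have fore_eq: "fore_period e A' i = fore_period e A i" if "1 \<le> i" "i < k" for i
  proof (rule fore_eqI[where n = "k - 1", OF assms(2)])
    fix i assume i: "1 \<le> i" "i \<le> k - 1"
    then have "top (rest A i - set P \<union> set N) (fore_period e A i)"
      by (intro top_insert_smaller fore_top assms) auto
    then show "top (A' - (\<Union>j\<in>{1..<i}. set (fore_period e A j))) (fore_period e A i)"
      using rest_eq[of i] i by simp
  qed (use that in auto)
  then show "1 \<le> i \<Longrightarrow> i < k \<Longrightarrow> fore_period e A' i = fore_period e A i" by blast
  show "rest A' i = rest A i - set P \<union> set N" if "i \<le> k"
    using rest_eq[OF that] fore_eq that by (simp add: rest_def)
qed

text \<open>A condition on the fore periods of A alone. It turns out to characterise the existence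
  of a downstream step, although that notion refers to the aft period of the target.\<close>

definition movable :: "bead set \<Rightarrow> nat \<Rightarrow> bool" where
  "movable A k \<longleftrightarrow> 1 \<le> k \<and>
     (k = 1 \<or> move 1 (fore_period e A k) \<lless> fore_period e A (k - 1))"

lemma movable_lt:
  assumes "is_abacus l A" "movable A k" "1 \<le> j" "j < k"
  shows "move 1 (fore_period e A k) \<lless> fore_period e A j"
  using assms(2-4) lt_le_trans[OF _ fore_le[OF assms(1,3), of "k - 1"]]
  by (auto simp: movable_def)

text \<open>A bead hit by the shift would lie in \<open>rest A k\<close>, because the shift avoids
  the earlier fore periods; there it contradicts the extremality of the k-th one.\<close>

lemma shifted_fore_disjoint:
  assumes A: "is_abacus l A" and mov: "movable A k"
  shows "set (move 1 (fore_period e A k)) \<inter> (A - set (fore_period e A k)) = {}"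
proof (rule ccontr)
  let ?P = "fore_period e A k"
  have k: "1 \<le> k" using mov by (simp add: movable_def)
  note top = fore_top[OF A k] and P = fore_chain[OF A k]
  assume "set (move 1 ?P) \<inter> (A - set ?P) \<noteq> {}"
  then obtain c r where cr: "(c, r) \<in> set (move 1 ?P)" "(c, r) \<in> A" "(c, r) \<notin> set ?P" by auto
  have "(c, r) \<notin> set (fore_period e A j)" if "1 \<le> j" "j < k" for j
    using lt_disjoint[OF chain_move[OF P] fore_chain[OF A that(1)] movable_lt[OF A mov that]] cr(1)
    by blast
  then have mem: "(c, r) \<in> rest A k" using cr(2) by (auto simp: rest_def)
  have c: "start ?P - int e < c - 1" "c - 1 \<le> start ?P" "r = row_at ?P (c - 1)"
    using cr(1) by (auto simp: set_move chain_mem[OF P])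
  show False
  proof (cases "c = start ?P + 1")
    case True
    then show False using top_no_extension[OF top] mem c by fastforce
  next
    case False
    then have "row_at ?P c \<le> r" using c by (intro top_lowest[OF top mem]) auto
    moreover have "r \<le> row_at ?P c" using chain_step[OF P, of "c - 1"] c False by auto
    ultimately show False using cr(3) chain_in[OF P, of c] c False by auto
  qed
qed

text \<open>By the dichotomy, every chain among the new remaining beads is \<succeq> N or strictly
  left of N, and in the second case it avoids N and consists of old beads. This controls the later
  fore periods and the aft period alike.\<close>

lemma shift_fore:
  assumes A: "is_abacus l A" and mov: "movable A k"
    and A'_def: "A' = shift_right A (fore_period e A k)"
  shows shift_fore_abacus: "is_abacus l A'"
    and shift_fore_other: "1 \<le> i \<Longrightarrow> i \<noteq> k \<Longrightarrow> fore_period e A' i = fore_period e A i"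
    and shift_fore_same: "move 1 (fore_period e A k) \<preceq> fore_period e A' k"
    and shift_fore_aft: "aft_period e A' k = move 1 (fore_period e A k)"
    and shift_fore_downstream: "downstream e k A A'"
proof -
  let ?P = "fore_period e A k"
  let ?N = "move 1 ?P"
  have k: "1 \<le> k" using mov by (simp add: movable_def)
  note top = fore_top[OF A k] and P = fore_chain[OF A k]
  note N = chain_move[OF P, of 1]
  have A': "A' = A - set ?P \<union> set ?N" by (simp add: A'_def shift_right_def)
  show ab: "is_abacus l A'" unfolding A' by (intro is_abacus_replace A fore_subset k)
  have dis: "set ?P \<inter> set (fore_period e A j) = {}" if "1 \<le> j" "j < k" for j
    by (intro lt_disjoint P fore_chain fore_lt A that)
  have smaller: "1 \<le> i \<Longrightarrow> i < k \<Longrightarrow> fore_period e A' i = fore_period e A i"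
    "i \<le> k \<Longrightarrow> rest A' i = rest A i - set ?P \<union> set ?N" for i
    using fore_unchanged_smaller[OF A ab A' N, of k i] movable_lt[OF A mov] dis by auto
  let ?P' = "fore_period e A' k"
  have rest_k: "rest A' k = rest A k - set ?P \<union> set ?N" by (rule smaller(2)) auto
  note top' = fore_top[OF ab k] and P' = fore_chain[OF ab k]
  have "set ?N \<subseteq> rest A' k" unfolding rest_k by auto
  then show N_le: "?N \<preceq> ?P'" by (intro fore_greatest[OF ab k N])
  have P_le: "?P \<preceq> ?P'" by (rule le_trans[OF le_move_right[OF P] N_le])
  have rest_Suc: "rest A (Suc k) = rest A k - set ?P"
    using k by (auto simp: rest_def atLeastLessThanSuc)
  \<comment> \<open>Two disjoint periods right of \<open>N\<close> are impossible: the right one would avoid \<open>N\<close>,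
    so it would be a period right of \<open>P\<close> consisting of old beads.\<close>
  have lt_N: "C \<lless> ?N" if C: "chain C" "set C \<subseteq> rest A' k" "set C \<inter> set ?P' = {}" for C
  proof (rule ccontr)
    assume "\<not> C \<lless> ?N"
    then have NC: "?N \<preceq> C"
      using shifted_top_dichotomy[OF top C(1)] C(2) rest_k by blast
    have "C \<preceq> ?P'" by (rule fore_greatest[OF ab k C(1,2)])
    then have "C \<lless> ?P'" using C(3) by (rule le_disjoint_imp_lt[OF C(1) P'])
    then have N_lt: "?N \<lless> ?P'" by (rule le_lt_trans[OF NC])
    then have "set ?P' \<subseteq> rest A k"
      using lt_disjoint[OF N P'] fore_subset_rest[OF ab k] rest_k by blast
    then have "?P' \<preceq> ?P" by (rule fore_greatest[OF A k P'])
    moreover have "?P \<lless> ?P'" by (rule le_lt_trans[OF le_move_right[OF P] N_lt])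
    ultimately show False using lt_le_trans lt_irrefl by blast
  qed
  have old: "set C \<subseteq> rest A (Suc k)" if "chain C" "set C \<subseteq> rest A' k" "C \<lless> ?N" for C
    using lt_disjoint[OF that(1) N that(3)] that(2) rest_k rest_Suc by blast
  let ?R = "\<lambda>i. if i = k then ?P' else fore_period e A i"
  have R_top: "top (A' - (\<Union>j\<in>{1..<i}. set (?R j))) (?R i)" if i: "1 \<le> i" for i
  proof (cases "i \<le> k")
    case True
    then have "(\<Union>j\<in>{1..<i}. set (?R j)) = (\<Union>j\<in>{1..<i}. set (fore_period e A' j))"
      using smaller(1) by auto
    moreover have "?R i = fore_period e A' i" using True smaller(1)[of i] i by auto
    ultimately show ?thesis using fore_top[OF ab i] by (simp add: rest_def)
  next
    case False
    then have ki: "k < i" by simp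
    let ?X = "A' - (\<Union>j\<in>{1..<i}. set (?R j))"
    let ?U = "\<Union>j\<in>{k<..<i}. set (fore_period e A j)"
    have split: "{1..<i} = {1..<k} \<union> {k} \<union> {k<..<i}" using ki k by auto
    have "(\<Union>j\<in>{1..<k}. set (?R j)) = (\<Union>j\<in>{1..<k}. set (fore_period e A' j))"
      using smaller(1) by auto
    then have X: "?X = rest A' k - set ?P' - ?U"
      unfolding split by (auto simp: rest_def)
    have "{1..<i} = {1..<Suc k} \<union> {k<..<i}" using ki k by auto
    then have rest_i: "rest A i = rest A (Suc k) - ?U" by (auto simp: rest_def)
    have "top ?X (fore_period e A i)"
    proof (rule topI)
      show ch: "chain (fore_period e A i)" by (rule fore_chain[OF A i])
      have "fore_period e A i \<lless> ?P'" by (rule lt_le_trans[OF fore_lt[OF A k ki] P_le])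
      then have "set (fore_period e A i) \<inter> set ?P' = {}" by (rule lt_disjoint[OF ch P'])
      then show "set (fore_period e A i) \<subseteq> ?X"
        using fore_subset_rest[OF A i] unfolding X rest_i rest_Suc rest_k by blast
      fix C assume C: "chain C" "set C \<subseteq> ?X"
      then have "set C \<subseteq> rest A' k" "set C \<inter> set ?P' = {}" "set C \<inter> ?U = {}"
        unfolding X by blast+
      \<comment> \<open>A chain avoiding the new k-th fore period lies strictly left of N, so it was
        already available in A.\<close>
      then have "set C \<subseteq> rest A i" unfolding rest_i using lt_N old C(1) by blast
      then show "C \<preceq> fore_period e A i" by (rule fore_greatest[OF A i C(1)])
    qed
    then show ?thesis using ki by simp
  qed
  show other: "fore_period e A' i = fore_period e A i" if "1 \<le> i" "i \<noteq> k" for i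
    using fore_eqI[OF ab, of i ?R i] R_top that by simp
  have lt_next: "fore_period e A (k + 1) \<lless> ?N"
    using k by (intro lt_le_trans[OF fore_lt[OF A k] le_move_right[OF P]]) simp
  show aft: "aft_period e A' k = ?N"
  proof (rule aft_eqI[OF ab k N])
    show "set ?N \<subseteq> rest A' k" by fact
    show "fore_period e A' (k + 1) \<lless> ?N" using lt_next other[of "k + 1"] by simp
    fix C assume C: "chain C" "set C \<subseteq> rest A' k" "fore_period e A' (k + 1) \<lless> C"
    \<comment> \<open>Otherwise C would be a quasiperiod left over in A after step k, hence
      \<preceq> the fore period with index k + 1, although it lies strictly right of it.\<close>
    show "?N \<preceq> C"
    proof (rule ccontr)
      assume "\<not> ?N \<preceq> C"
      then have "C \<lless> ?N" using shifted_top_dichotomy[OF top C(1)] C(2) rest_k by blast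
      then have "set C \<subseteq> rest A (k + 1)" using old[OF C(1,2)] by simp
      then have "C \<preceq> fore_period e A (k + 1)" using k by (intro fore_greatest[OF A _ C(1)]) auto
      moreover have "fore_period e A (k + 1) \<lless> C" using C(3) other[of "k + 1"] by simp
      ultimately have "C \<lless> C" by (rule le_lt_trans)
      then show False by simp
    qed
  qed
  show "downstream e k A A'"
    unfolding downstream_def right_shiftable_iff[OF P]
    by (intro conjI shifted_fore_disjoint[OF A mov] aft[symmetric] A'_def)
qed

lemma downstreamD:
  assumes "downstream e k A A'"
  shows "right_shiftable A (fore_period e A k)" "A' = shift_right A (fore_period e A k)"
    "aft_period e A' k = move 1 (fore_period e A k)"
  using assms unfolding downstream_def by (blast, blast, metis)

lemma upstreamD:
  assumes "upstream e k A A'"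
  shows "left_shiftable A' (aft_period e A' k)" "A = shift_left A' (aft_period e A' k)"
    "fore_period e A k = move (-1) (aft_period e A' k)"
  using assms unfolding upstream_def by (blast, blast, metis)

text \<open>As an aft period of A', N avoids all fore periods of A' with smaller index. At the first
  j where N is not strictly left of the j-th fore period of A, that period is therefore unchanged in
  A'; being \<preceq> it and disjoint from it, N is strictly left of it after all.\<close>

lemma downstream_imp_movable:
  assumes A: "is_abacus l A" and k: "1 \<le> k" and down: "downstream e k A A'"
  shows "movable A k"
proof (rule ccontr)
  let ?P = "fore_period e A k"
  let ?N = "move 1 ?P"
  assume not_mov: "\<not> movable A k"
  note P = fore_chain[OF A k]
  note N = chain_move[OF P, of 1]
  have A': "A' = A - set ?P \<union> set ?N" and aft: "aft_period e A' k = ?N"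
    using downstreamD[OF down] unfolding shift_right_def by blast+
  have ab: "is_abacus l A'" unfolding A' by (intro is_abacus_replace A fore_subset k)
  have "1 \<le> k - 1 \<and> k - 1 < k \<and> \<not> ?N \<lless> fore_period e A (k - 1)"
    using not_mov k by (auto simp: movable_def)
  then obtain j where j: "1 \<le> j" "j < k" "\<not> ?N \<lless> fore_period e A j"
    and min: "\<And>i. i < j \<Longrightarrow> 1 \<le> i \<Longrightarrow> ?N \<lless> fore_period e A i"
    using exists_least_iff[of "\<lambda>j. 1 \<le> j \<and> j < k \<and> \<not> ?N \<lless> fore_period e A j"] by auto
  have dis: "set ?P \<inter> set (fore_period e A i) = {}" if "1 \<le> i" "i < k" for i
    by (intro lt_disjoint P fore_chain fore_lt A that)
  have rest_j: "rest A' j = rest A j - set ?P \<union> set ?N"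
    using fore_unchanged_smaller(2)[OF A ab A' N, of j j] min dis j by auto
  let ?T = "fore_period e A' j"
  note T = fore_chain[OF ab j(1)]
  have "set ?N \<subseteq> rest A' k"
    using bottomD(2)[OF aft_bottom[OF ab k]] aft by auto
  then have N_dis: "set ?T \<inter> set ?N = {}" using j by (auto simp: rest_def)
  have "set (fore_period e A j) \<subseteq> rest A' j"
    using rest_j fore_subset_rest[OF A j(1)] dis[OF j(1,2)] by auto
  then have "fore_period e A j \<preceq> ?T" by (intro fore_greatest[OF ab j(1)] fore_chain A j)
  moreover have "?T \<preceq> fore_period e A j"
    using fore_subset_rest[OF ab j(1)] rest_j N_dis by (intro fore_greatest[OF A j(1) T]) auto
  ultimately have "?T = fore_period e A j"
    by (intro le_antisym T fore_chain A j)
  moreover have "?N \<preceq> ?T" using rest_j by (intro fore_greatest[OF ab j(1) N]) auto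
  then have "?N \<lless> ?T" using N_dis by (intro le_disjoint_imp_lt N T) auto
  ultimately show False using j(3) by simp
qed

lemma downstream_iff:
  assumes "is_abacus l A" "1 \<le> k"
  shows "downstream e k A A' \<longleftrightarrow> movable A k \<and> A' = shift_right A (fore_period e A k)"
  using downstream_imp_movable[OF assms] shift_fore_downstream[OF assms(1)] downstreamD(2)
  by blast

lemma downstream_abacus:
  assumes "is_abacus l A" "1 \<le> k" "downstream e k A A'" shows "is_abacus l A'"
  using shift_fore_abacus[OF assms(1)] downstream_iff[OF assms(1,2)] assms(3) by blast

lemma downstream_iff_upstream:
  assumes A: "is_abacus l A" and A': "is_abacus l A'" and k: "1 \<le> k"
  shows "downstream e k A A' \<longleftrightarrow> upstream e k A A'"
proof
  let ?P = "fore_period e A k"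
  note P = fore_chain[OF A k]
  assume down: "downstream e k A A'"
  have "set (move 1 ?P) \<inter> (A - set ?P) = {}" "A' = A - set ?P \<union> set (move 1 ?P)"
    and aft: "aft_period e A' k = move 1 ?P"
    using downstreamD[OF down] unfolding right_shiftable_iff[OF P] shift_right_def by blast+
  note inv = shifts_inverse[OF fore_subset[OF A k] this(1,2)]
  have "move (-1) (move 1 ?P) = ?P" by simp
  then show "upstream e k A A'"
    unfolding upstream_def aft left_shiftable_iff[OF chain_move[OF P]] shift_left_def
    using inv(1,2) by simp
next
  let ?Q = "aft_period e A' k"
  note Q = bottomD(1)[OF aft_bottom[OF A' k]]
  have QA: "set ?Q \<subseteq> A'" using bottomD(2)[OF aft_bottom[OF A' k]] by (auto simp: rest_def)
  assume up: "upstream e k A A'"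
  have "set (move (-1) ?Q) \<inter> (A' - set ?Q) = {}" "A = A' - set ?Q \<union> set (move (-1) ?Q)"
    and fore: "fore_period e A k = move (-1) ?Q"
    using upstreamD[OF up] unfolding left_shiftable_iff[OF Q] shift_left_def by blast+
  note inv = shifts_inverse[OF QA this(1,2)]
  have "move 1 (move (-1) ?Q) = ?Q" by simp
  then show "downstream e k A A'"
    unfolding downstream_def fore right_shiftable_iff[OF chain_move[OF Q]] shift_right_def
    using inv(1,2) by simp
qed

section \<open>Determinism of arrows and the two diamond properties\<close>

lemma downstream_functional:
  "downstream e k A B \<Longrightarrow> downstream e k A C \<Longrightarrow> B = C"
  using downstreamD(2) by blast

lemma downstream_injective:
  assumes "is_abacus l A" "is_abacus l B" "1 \<le> k" "downstream e k A C" "downstream e k B C"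
  shows "A = B"
proof -
  note C = downstream_abacus[OF assms(1,3,4)]
  have "A = shift_left C (aft_period e C k)" "B = shift_left C (aft_period e C k)"
    using downstream_iff_upstream[OF _ C assms(3)] upstreamD(2) assms by blast+
  then show ?thesis by simp
qed

text \<open>The fore period with index k + 1 stays fixed while the k-th becomes \<succeq> its own
  shift, which leaves room to shift the next one.\<close>

lemma downstream_imp_movable_next:
  assumes B: "is_abacus l B" and k: "1 \<le> k" and down: "downstream e k B A"
  shows "movable A (k + 1)"
proof -
  have mov: "movable B k" and A: "A = shift_right B (fore_period e B k)"
    using down downstream_iff[OF B k] by auto
  have "fore_period e A (k + 1) = fore_period e B (k + 1)"
    by (rule shift_fore_other[OF B mov A]) auto
  moreover have "move 1 (fore_period e B (k + 1)) \<lless> move 1 (fore_period e B k)"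
    using k by (intro lt_move fore_chain fore_lt B) auto
  ultimately have "move 1 (fore_period e A (k + 1)) \<lless> fore_period e A k"
    using shift_fore_same[OF B mov A] lt_le_trans by simp
  then show ?thesis by (simp add: movable_def)
qed

text \<open>B is A with its k-th aft period Q shifted left. The point is that this shift stays
  strictly right of p, so that it becomes the k-th fore period of B.\<close>

lemma movable_next_imp_downstream:
  assumes A: "is_abacus l A" and k: "1 \<le> k" and mov: "movable A (k + 1)"
  obtains B where "is_abacus l B" "downstream e k B A"
proof -
  define p where "p = fore_period e A (k + 1)"
  let ?P = "fore_period e A k" and ?Q = "aft_period e A k"
  let ?Y = "rest A k \<inter> below p"
  let ?M = "move (-1) ?Q"
  have k1: "1 \<le> k + 1" by simp
  note p = fore_chain[OF A k1, folded p_def] and p_top = fore_top[OF A k1, folded p_def]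
    and P = fore_chain[OF A k]
  have bot: "bottom ?Y ?Q" by (rule aft_bottom[OF A k, folded p_def])
  note Q = bottomD[OF bot]
  note M = chain_move[OF Q(1), of "-1"]
  have rest_Suc: "rest A (k + 1) = rest A k - set ?P"
    using k by (auto simp: rest_def atLeastLessThanSuc)
  have pQ: "p \<lless> ?Q" using Q(2) subset_below_iff[OF Q(1)] by blast
  have QP: "?Q \<preceq> ?P" using Q(2) by (intro fore_greatest[OF A k Q(1)]) auto
  have NP: "move 1 p \<lless> ?P" using mov k by (simp add: movable_def p_def)
  \<comment> \<open>A bead of \<open>Q\<close> on or above the shift of \<open>p\<close> would be free, contradicting that \<open>p\<close> is
    leftmost-lowest among the remaining beads.\<close>
  have NQ: "move 1 p \<lless> ?Q"
    unfolding lt_def start_move[OF p]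
  proof (intro conjI allI impI)
    show "start p + 1 \<le> start ?Q"
    proof (rule ccontr)
      assume "\<not> start p + 1 \<le> start ?Q"
      then have eq: "start ?Q = start p" using pQ by (simp add: lt_def)
      \<comment> \<open>The leftmost column of p, which the k-th fore period does not reach because
        it starts further right.\<close>
      define c where "c = start p - int e + 1"
      have c: "start p - int e < c" "c \<le> start p" using e_pos by (auto simp: c_def)
      have "(c, row_at ?Q c) \<in> rest A k"
        using chain_in[OF Q(1), of c] Q(2) c eq by auto
      moreover have "(c, row_at ?Q c) \<notin> set ?P"
        using NP by (auto simp: chain_mem[OF P] lt_def start_move[OF p] c_def)
      ultimately have mem: "(c, row_at ?Q c) \<in> rest A (k + 1)" unfolding rest_Suc by simp
      have "row_at p c \<le> row_at ?Q c"
        by (rule top_lowest[OF p_top mem c]) (simp add: c_def)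
      moreover have "row_at ?Q c < row_at p c" using pQ c eq by (auto simp: lt_def)
      ultimately show False by simp
    qed
    fix c assume c: "start ?Q - int e < c" "c \<le> start p + 1"
    have cp: "start p - int e < c - 1"
      using c \<open>start p + 1 \<le> start ?Q\<close> by simp
    have N_row: "row_at (move 1 p) c = row_at p (c - 1)"
      using c cp by (intro row_at_move[OF p]) auto
    have cQ: "c \<le> start ?Q" using c \<open>start p + 1 \<le> start ?Q\<close> by simp
    show "row_at ?Q c < row_at (move 1 p) c"
    proof (rule ccontr)
      assume "\<not> row_at ?Q c < row_at (move 1 p) c"
      then have ge: "row_at p (c - 1) \<le> row_at ?Q c" using N_row by simp
      have "(c, row_at ?Q c) \<notin> set ?P"
        using NP c ge N_row by (auto simp: chain_mem[OF P] lt_def start_move[OF p])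
      then have mem: "(c, row_at ?Q c) \<in> rest A (k + 1)"
        using chain_in[OF Q(1) c(1) cQ] Q(2) unfolding rest_Suc by auto
      show False
      proof (cases "c = start p + 1")
        case True
        then show False using top_no_extension[OF p_top] mem ge by fastforce
      next
        case False
        then have "row_at p c \<le> row_at ?Q c"
          using c cp ge by (intro top_lowest[OF p_top mem]) auto
        moreover have "row_at ?Q c < row_at p c" using pQ c False by (auto simp: lt_def)
        ultimately show False by simp
      qed
    qed
  qed
  have pM: "p \<lless> ?M" using lt_move[OF chain_move[OF p] Q(1) NQ, of "-1"] by simp
  have MP: "?M \<preceq> ?P" by (rule le_trans[OF le_move_left[OF Q(1)] QP])
  have M_lt: "?M \<lless> fore_period e A j" if "1 \<le> j" "j < k" for j
    by (rule le_lt_trans[OF MP fore_lt[OF A that]])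
  have Q_dis: "set ?Q \<inter> set (fore_period e A j) = {}" if "1 \<le> j" "j < k" for j
    by (intro lt_disjoint Q fore_chain A that le_lt_trans[OF QP fore_lt[OF A that]])
  define B where "B = A - set ?Q \<union> set ?M"
  have QA: "set ?Q \<subseteq> A" using Q(2) by (auto simp: rest_def)
  have ab: "is_abacus l B" unfolding B_def by (intro is_abacus_replace A QA)
  have rest_k: "rest B k = rest A k - set ?Q \<union> set ?M"
    using fore_unchanged_smaller(2)[OF A ab B_def M, of k k] M_lt Q_dis by auto
  have "top (rest B k) ?M"
  proof (rule topI)
    show "chain ?M" by (rule M)
    show "set ?M \<subseteq> rest B k" unfolding rest_k by auto
    fix C assume C: "chain C" "set C \<subseteq> rest B k"
    \<comment> \<open>Passing to the join puts every competitor strictly right of p, the region in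
      which Q is least.\<close>
    let ?J = "join C ?M"
    have J: "chain ?J" "C \<preceq> ?J" "?M \<preceq> ?J"
      by (simp_all add: C(1) M chain_join le_join1 le_join2)
    have J_rest: "set ?J \<subseteq> rest B k"
      using set_join[OF C(1) M] C(2) \<open>set ?M \<subseteq> rest B k\<close> by blast
    have "set ?J \<subseteq> below p" "set ?M \<subseteq> below p"
      using subset_below_iff[OF J(1)] subset_below_iff[OF M] lt_le_trans[OF pM J(3)] pM by blast+
    then have J_sub: "set ?J \<subseteq> ?Y - set ?Q \<union> set ?M" using J_rest rest_k by blast
    have "?J = ?M"
    proof (rule ccontr)
      \<comment> \<open>Then J consists of unmoved beads, so Q lies strictly left of the k-th fore
        period and is still available for index k + 1. This gives Q \<preceq> p, against p \<lless>
        Q.\<close>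
      assume "?J \<noteq> ?M"
      then have "?M \<lless> ?J" by (rule shifted_bottom_le[OF bot J(1) J_sub J(3)])
      then have "set ?M \<inter> set ?J = {}" by (rule lt_disjoint[OF M J(1)])
      then have J_old: "set ?J \<subseteq> ?Y" "set ?Q \<inter> set ?J = {}" using J_sub by blast+
      then have "?Q \<lless> ?J" using le_disjoint_imp_lt[OF Q(1) J(1)] Q(3)[OF J(1)] by blast
      moreover have "?J \<preceq> ?P" using J_old by (intro fore_greatest[OF A k J(1)]) auto
      ultimately have "?Q \<lless> ?P" by (rule lt_le_trans)
      then have "set ?Q \<subseteq> rest A (k + 1)"
        using lt_disjoint[OF Q(1) P] Q(2) rest_Suc by blast
      then have "?Q \<preceq> p" by (rule fore_greatest[OF A k1 Q(1), folded p_def])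
      then have "?Q \<lless> ?Q" using pQ by (rule le_lt_trans)
      then show False by simp
    qed
    then show "C \<preceq> ?M" using J(2) by simp
  qed
  then have fore: "fore_period e B k = ?M" using top_unique fore_top[OF ab k] by blast
  have dis: "set ?M \<inter> (A - set ?Q) = {}"
  proof (rule ccontr)
    assume "set ?M \<inter> (A - set ?Q) \<noteq> {}"
    then obtain c r where cr: "(c, r) \<in> set ?M" "(c, r) \<in> A" "(c, r) \<notin> set ?Q" by auto
    have "(c, r) \<notin> set (fore_period e A j)" if "1 \<le> j" "j < k" for j
      using lt_disjoint[OF M fore_chain[OF A that(1)] M_lt[OF that]] cr(1) by blast
    moreover have "(c, r) \<in> below p" using pM subset_below_iff[OF M] cr(1) by blast
    ultimately have mem: "(c, r) \<in> ?Y" using cr(2) by (auto simp: rest_def)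
    have c: "start ?Q - int e < c + 1" "c + 1 \<le> start ?Q" "r = row_at ?Q (c + 1)"
      using cr(1) by (auto simp: set_move chain_mem[OF Q(1)])
    show False
    proof (cases "c = start ?Q - int e")
      case True
      then show False using bottom_no_extension[OF bot] mem c by fastforce
    next
      case False
      then have "r \<le> row_at ?Q c" using c by (intro bottom_highest[OF bot mem]) auto
      moreover have "row_at ?Q c \<le> r" using chain_step[OF Q(1), of c] c False by auto
      ultimately show False using cr(3) chain_in[OF Q(1), of c] c False by auto
    qed
  qed
  have "upstream e k B A"
    unfolding upstream_def left_shiftable_iff[OF Q(1)] shift_left_def
    using dis B_def fore by simp
  then show thesis using that ab downstream_iff_upstream[OF ab A k] by blast
qed

text \<open>If j = k - 1, the neighbour bounding the k-th period only moves right; otherwise it is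
  unchanged. The disjointness makes the two shifts commute as set operations.\<close>

lemma downstream_keeps_movable:
  assumes X: "is_abacus l X" and jk: "1 \<le> j" "1 \<le> k" "j \<noteq> k"
    and Y: "downstream e j X Y" and Z: "downstream e k X Z"
  shows "movable Y k" "fore_period e Y k = fore_period e X k"
    "set (move 1 (fore_period e X j)) \<inter> set (fore_period e X k) = {}"
proof -
  let ?N = "move 1 (fore_period e X j)"
  have j: "movable X j" "Y = shift_right X (fore_period e X j)" and k: "movable X k"
    using jk Y Z downstream_iff[OF X] by auto
  note N = chain_move[OF fore_chain[OF X jk(1)], of 1]
  note ab = downstream_abacus[OF X jk(1) Y]
  show same: "fore_period e Y k = fore_period e X k"
    using jk by (intro shift_fore_other[OF X j]) auto
  have "fore_period e X (k - 1) \<preceq> fore_period e Y (k - 1)" if "k \<noteq> 1"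
  proof (cases "k - 1 = j")
    case True
    then show ?thesis
      using le_trans[OF le_move_right[OF fore_chain[OF X jk(1)]] shift_fore_same[OF X j]] by simp
  next
    case False
    then show ?thesis using shift_fore_other[OF X j, of "k - 1"] that jk by simp
  qed
  then show "movable Y k" using k same lt_le_trans by (auto simp: movable_def)
  have sub: "set ?N \<subseteq> rest Y j" and lt: "fore_period e Y (j + 1) \<lless> ?N"
    using bottomD(2)[OF aft_bottom[OF ab jk(1)]] subset_below_iff[OF N]
    unfolding downstreamD(3)[OF Y] by blast+
  show "set ?N \<inter> set (fore_period e X k) = {}"
  proof (cases "k < j")
    case True
    then have "set (fore_period e Y k) \<inter> rest Y j = {}" using jk by (auto simp: rest_def)
    then show ?thesis using sub same by auto
  next
    case False
    then have "fore_period e Y k \<preceq> fore_period e Y (j + 1)"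
      using jk by (intro fore_le[OF ab]) auto
    then have "fore_period e X k \<lless> ?N" using le_lt_trans[OF _ lt] same by simp
    then show ?thesis using lt_disjoint[OF fore_chain[OF X jk(2)] N] by blast
  qed
qed

lemma downstream_diamond:
  assumes X: "is_abacus l X" and jk: "1 \<le> j" "1 \<le> k" "j \<noteq> k"
    and Y: "downstream e j X Y" and Z: "downstream e k X Z"
  obtains W where "downstream e k Y W" "downstream e j Z W"
proof -
  note ab = downstream_abacus[OF X jk(1) Y] downstream_abacus[OF X jk(2) Z]
  note Yk = downstream_keeps_movable[OF X jk Y Z]
  note Zj = downstream_keeps_movable[OF X jk(2,1) jk(3)[symmetric] Z Y]
  let ?Pj = "fore_period e X j" and ?Pk = "fore_period e X k"
  have "Y = X - set ?Pj \<union> set (move 1 ?Pj)" "Z = X - set ?Pk \<union> set (move 1 ?Pk)"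
    using downstreamD(2)[OF Y] downstreamD(2)[OF Z] unfolding shift_right_def by blast+
  then have "shift_right Y ?Pk = shift_right Z ?Pj"
    unfolding shift_right_def using Yk(3) Zj(3) by blast
  moreover have "downstream e k Y (shift_right Y ?Pk)"
    using Yk jk downstream_iff[OF ab(1)] by simp
  moreover have "downstream e j Z (shift_right Z ?Pj)"
    using Zj jk downstream_iff[OF ab(2)] by simp
  ultimately show thesis using that by simp
qed

text \<open>The arrow k into W makes k + 1 movable in W. The arrow j changes the fore periods k and
  k + 1 in no way, so k + 1 is movable in Z already, which yields an arrow k into Z. The square is
  then closed downstream and its corner identified by injectivity.\<close>

lemma downstream_codiamond_aux:
  assumes ab: "is_abacus l Y" "is_abacus l Z" and jk: "1 \<le> j" "1 \<le> k" "j \<noteq> k" "j \<noteq> k + 1"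
    and Y: "downstream e k Y W" and Z: "downstream e j Z W"
  obtains X where "is_abacus l X" "downstream e j X Y" "downstream e k X Z"
proof -
  have j: "movable Z j" "W = shift_right Z (fore_period e Z j)"
    using Z downstream_iff[OF ab(2)] jk by auto
  have W: "is_abacus l W" by (rule downstream_abacus[OF ab(1) jk(2) Y])
  have "movable W (k + 1)" by (rule downstream_imp_movable_next[OF ab(1) jk(2) Y])
  moreover have "fore_period e Z (k + 1) = fore_period e W (k + 1)"
    "fore_period e Z k = fore_period e W k"
    using shift_fore_other[OF ab(2) j] jk by auto
  ultimately have "movable Z (k + 1)" by (simp add: movable_def)
  then obtain X where X: "is_abacus l X" "downstream e k X Z"
    by (rule movable_next_imp_downstream[OF ab(2) jk(2)])
  have k: "movable X k" "Z = shift_right X (fore_period e X k)"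
    using X(2) downstream_iff[OF X(1)] jk by auto
  have "fore_period e X j = fore_period e Z j"
    using shift_fore_other[OF X(1) k] jk by simp
  moreover have "fore_period e X (j - 1) = fore_period e Z (j - 1)" if "j \<noteq> 1"
    using shift_fore_other[OF X(1) k, of "j - 1"] jk that by simp
  ultimately have "movable X j" using j(1) by (cases "j = 1") (simp_all add: movable_def)
  then obtain Y' where Y': "downstream e j X Y'" using downstream_iff[OF X(1)] jk by blast
  then obtain W' where W': "downstream e k Y' W'" "downstream e j Z W'"
    using downstream_diamond[OF X(1) jk(1-3) Y' X(2)] by blast
  have "W' = W" using W'(2) Z by (rule downstream_functional)
  then have "Y' = Y"
    using downstream_injective[OF downstream_abacus[OF X(1) jk(1) Y'] ab(1) jk(2)] W'(1) Y by blast
  then show thesis using that X Y' by blast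
qed

text \<open>For j = k + 1 the roles are exchanged, since then k differs from both j and j +
  1.\<close>

lemma downstream_codiamond:
  assumes "is_abacus l Y" "is_abacus l Z" and jk: "1 \<le> j" "1 \<le> k" "j \<noteq> k"
    and "downstream e k Y W" "downstream e j Z W"
  obtains X where "is_abacus l X" "downstream e j X Y" "downstream e k X Z"
proof (cases "j = k + 1")
  case True
  then show thesis
    using downstream_codiamond_aux[of Z Y k j W] assms that by auto
next
  case False
  then show thesis using downstream_codiamond_aux[of Y Z j k W] assms that by blast
qed

end

section \<open>Young's lattice over a source\<close>

definition removable :: "(nat \<Rightarrow> nat) \<Rightarrow> nat \<Rightarrow> bool" where
  "removable \<theta> k \<longleftrightarrow> 1 \<le> k \<and> \<theta> (Suc k) < \<theta> k"

definition remove_box :: "nat \<Rightarrow> (nat \<Rightarrow> nat) \<Rightarrow> (nat \<Rightarrow> nat)" where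
  "remove_box k \<theta> = \<theta>(k := \<theta> k - 1)"

definition boxes :: "(nat \<Rightarrow> nat) \<Rightarrow> nat" where
  "boxes \<theta> = sum \<theta> {i. \<theta> i \<noteq> 0}"

lemma partition_remove_box:
  assumes "is_partition \<theta>" "removable \<theta> k" shows "is_partition (remove_box k \<theta>)"
proof -
  have "finite {i. remove_box k \<theta> i \<noteq> 0}"
    by (rule finite_subset[of _ "{i. \<theta> i \<noteq> 0}"])
      (use assms in \<open>auto simp: is_partition_def remove_box_def\<close>)
  moreover have "remove_box k \<theta> (Suc i) \<le> remove_box k \<theta> i" if "1 \<le> i" for i
  proof -
    have "\<theta> (Suc i) \<le> \<theta> i" using assms(1) that by (simp add: is_partition_def)
    then show ?thesis using assms(2) by (auto simp: remove_box_def removable_def)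
  qed
  ultimately show ?thesis using assms by (auto simp: is_partition_def remove_box_def)
qed

lemma boxes_remove_box:
  assumes "is_partition \<theta>" "removable \<theta> k" shows "boxes (remove_box k \<theta>) < boxes \<theta>"
proof -
  let ?S = "{i. \<theta> i \<noteq> 0}"
  have fin: "finite ?S" using assms by (simp add: is_partition_def)
  have "boxes (remove_box k \<theta>) = sum (remove_box k \<theta>) ?S"
    unfolding boxes_def by (rule sum.mono_neutral_left[OF fin]) (auto simp: remove_box_def)
  also have "\<dots> < sum \<theta> ?S"
    using assms(2) by (intro sum_strict_mono_ex1[OF fin]) (auto simp: remove_box_def removable_def)
  finally show ?thesis by (simp add: boxes_def)
qed

lemma partition_antimono:
  assumes "is_partition \<theta>" "1 \<le> i" "i \<le> j" shows "\<theta> j \<le> \<theta> i"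
  using assms(3)
proof (induction j rule: dec_induct)
  case (step j)
  then have "\<theta> (Suc j) \<le> \<theta> j" using assms by (simp add: is_partition_def)
  then show ?case using step by simp
qed simp

lemma partition_support:
  assumes "is_partition \<theta>" shows "{i. \<theta> i \<noteq> 0} = {1..card {i. \<theta> i \<noteq> 0}}"
proof (cases "{i. \<theta> i \<noteq> 0} = {}")
  case False
  let ?S = "{i. \<theta> i \<noteq> 0}"
  have fin: "finite ?S" using assms by (simp add: is_partition_def)
  have "?S = {1..Max ?S}"
  proof (intro set_eqI iffI)
    fix i assume i: "i \<in> ?S"
    then have "i \<noteq> 0" using assms by (cases i) (auto simp: is_partition_def)
    then show "i \<in> {1..Max ?S}" using Max_ge[OF fin i] by simp
  next
    fix i assume i: "i \<in> {1..Max ?S}"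
    then have "\<theta> (Max ?S) \<le> \<theta> i" by (intro partition_antimono[OF assms]) auto
    then show "i \<in> ?S" using Max_in[OF fin False] by auto
  qed
  then show ?thesis by (metis card_atLeastAtMost diff_Suc_1)
qed simp

lemma last_row:
  assumes "is_partition \<theta>" "\<theta> \<noteq> (\<lambda>_. 0)"
  obtains n where "removable \<theta> n" "\<And>i. n < i \<Longrightarrow> \<theta> i = 0"
proof
  let ?n = "card {i. \<theta> i \<noteq> 0}"
  have supp: "\<theta> i \<noteq> 0 \<longleftrightarrow> 1 \<le> i \<and> i \<le> ?n" for i
    using partition_support[OF assms(1)] by auto
  obtain i where "\<theta> i \<noteq> 0" using assms(2) by auto
  then have "1 \<le> ?n" using supp[of i] by linarith
  then show "removable \<theta> ?n" using supp[of ?n] supp[of "Suc ?n"] by (simp add: removable_def)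
  show "\<theta> i = 0" if "?n < i" for i using supp[of i] that by linarith
qed

section \<open>The operators \<open>b_op\<close>, row by row\<close>

lemma b_rows_cong:
  assumes "\<And>i. 1 \<le> i \<Longrightarrow> i \<le> n \<Longrightarrow> \<theta> i = \<rho> i" shows "b_rows e \<theta> n A = b_rows e \<rho> n A"
  using assms by (induction n) auto

lemma b_op_eq_b_rows:
  assumes "is_partition \<theta>" "\<And>i. n < i \<Longrightarrow> \<theta> i = 0" shows "b_op e \<theta> A = b_rows e \<theta> n A"
proof -
  let ?c = "card {i. \<theta> i \<noteq> 0}"
  have supp: "\<theta> i \<noteq> 0 \<longleftrightarrow> 1 \<le> i \<and> i \<le> ?c" for i
    using partition_support[OF assms(1)] by auto
  have "?c \<le> n"
  proof (rule ccontr)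
    assume "\<not> ?c \<le> n"
    then show False using supp[of ?c] assms(2)[of ?c] by simp
  qed
  then have "b_rows e \<theta> n A = b_rows e \<theta> ?c A"
  proof (induction n rule: dec_induct)
    case (step n)
    then show ?case using supp[of "Suc n"] by simp
  qed simp
  then show ?thesis by (simp add: b_op_def)
qed

lemma b_op_empty [simp]: "b_op e (\<lambda>_. 0) A = A"
  by (simp add: b_op_def)

text \<open>The last shift performed by \<open>b_op\<close> belongs to the last row, so only for
  this row does the definition exhibit a removed box directly.\<close>

lemma b_op_last_row:
  assumes "is_partition \<theta>" "removable \<theta> n" "\<And>i. n < i \<Longrightarrow> \<theta> i = 0"
  shows "b_op e \<theta> A = shift_right (b_op e (remove_box n \<theta>) A)
    (fore_period e (b_op e (remove_box n \<theta>) A) n)"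
proof -
  let ?\<rho> = "remove_box n \<theta>"
  obtain m where m: "n = Suc m" using assms(2) by (cases n) (auto simp: removable_def)
  have "b_op e \<theta> A = b_rows e \<theta> n A" by (rule b_op_eq_b_rows[OF assms(1,3)])
  moreover have "b_op e ?\<rho> A = b_rows e ?\<rho> n A"
    by (rule b_op_eq_b_rows[OF partition_remove_box[OF assms(1,2)]])
      (simp add: remove_box_def assms(3))
  moreover have "b_rows e ?\<rho> m A = b_rows e \<theta> m A"
    by (rule b_rows_cong) (simp add: remove_box_def m)
  moreover have "\<theta> n = Suc (?\<rho> n)" using assms(2) by (simp add: remove_box_def removable_def)
  ultimately show ?thesis by (simp add: m)
qed

section \<open>Coordinates of an abacus: a source and a partition\<close>

context abaci
begin

lemma exists_downstream_iff:
  assumes "is_abacus l A" "1 \<le> k"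
  shows "(\<exists>B. is_abacus l B \<and> downstream e k B A) \<longleftrightarrow> movable A (k + 1)"
  using downstream_imp_movable_next[OF _ assms(2)] movable_next_imp_downstream[OF assms] by blast

definition source :: "bead set \<Rightarrow> bool" where
  "source H \<longleftrightarrow> is_abacus l H \<and> (\<forall>k\<ge>1. \<forall>B. is_abacus l B \<longrightarrow> \<not> downstream e k B H)"

text \<open>Removable rows match entering indices, and an entering index k means that k + 1 is
  movable. Boxes outside the last row are handled by a diamond over the partition with two boxes
  removed, spurious arrows by a codiamond.\<close>

lemma crystal_structure:
  assumes H: "source H" and "is_partition \<theta>"
  shows "is_abacus l (b_op e \<theta> H) \<and> (\<forall>k\<ge>1.
    ((\<exists>B. is_abacus l B \<and> downstream e k B (b_op e \<theta> H)) \<longleftrightarrow> removable \<theta> k) \<and>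
    (removable \<theta> k \<longrightarrow> downstream e k (b_op e (remove_box k \<theta>) H) (b_op e \<theta> H)))"
  using assms(2)
proof (induction "boxes \<theta>" arbitrary: \<theta> rule: less_induct)
  case less
  let ?A = "\<lambda>\<theta>. b_op e \<theta> H"
  have IH: "is_abacus l (?A \<rho>)"
      "\<And>k. 1 \<le> k \<Longrightarrow> (\<exists>B. is_abacus l B \<and> downstream e k B (?A \<rho>)) \<longleftrightarrow> removable \<rho> k"
      "\<And>k. removable \<rho> k \<Longrightarrow> downstream e k (?A (remove_box k \<rho>)) (?A \<rho>)"
    if "is_partition \<rho>" "boxes \<rho> < boxes \<theta>" for \<rho>
    using less(1)[OF that(2,1)] by (auto simp: removable_def)
  show ?case
  proof (cases "\<theta> = (\<lambda>_. 0)")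
    case True
    then show ?thesis using H by (auto simp: source_def removable_def)
  next
    case False
    then obtain n where n: "removable \<theta> n" "\<And>i. n < i \<Longrightarrow> \<theta> i = 0"
      using last_row[OF less(2)] by blast
    have n1: "1 \<le> n" using n(1) by (simp add: removable_def)
    define \<rho> where "\<rho> = remove_box n \<theta>"
    have \<rho>: "is_partition \<rho>" "boxes \<rho> < boxes \<theta>"
      using partition_remove_box boxes_remove_box less(2) n(1) by (auto simp: \<rho>_def)
    have mov: "movable (?A \<rho>) n"
    proof (cases "n = 1")
      case True
      then show ?thesis by (simp add: movable_def)
    next
      case False
      then have "\<theta> n \<le> \<theta> (n - 1)" using partition_antimono[OF less(2), of "n - 1" n] n1 by simp
      \<comment> \<open>Removing a box from row n leaves row n - 1 strictly longer, so an arrow n -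
        1 enters and n is movable.\<close>
      then have rem: "removable \<rho> (n - 1)"
        using False n(1) by (auto simp: removable_def \<rho>_def remove_box_def)
      have n2: "1 \<le> n - 1" "n - 1 + 1 = n" using False n1 by auto
      have "movable (?A \<rho>) (n - 1 + 1)"
        using IH(2)[OF \<rho> n2(1)] exists_downstream_iff[OF IH(1)[OF \<rho>] n2(1)] rem by blast
      then show ?thesis unfolding n2(2) .
    qed
    have last: "downstream e n (?A \<rho>) (?A \<theta>)"
      unfolding downstream_iff[OF IH(1)[OF \<rho>] n1]
      using mov b_op_last_row[OF less(2) n, of e H, folded \<rho>_def] by blast
    have ab: "is_abacus l (?A \<theta>)" by (rule downstream_abacus[OF IH(1)[OF \<rho>] n1 last])
    have rem: "downstream e j (?A (remove_box j \<theta>)) (?A \<theta>)" if j: "removable \<theta> j" for j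
    proof (cases "j = n")
      case True
      then show ?thesis using last by (simp add: \<rho>_def)
    next
      case False
      have j1: "1 \<le> j" using j by (simp add: removable_def)
      define \<tau> where "\<tau> = remove_box j \<theta>"
      have \<tau>: "is_partition \<tau>" "boxes \<tau> < boxes \<theta>"
        using partition_remove_box boxes_remove_box less(2) j by (auto simp: \<tau>_def)
      have eq: "remove_box j \<rho> = remove_box n \<tau>"
        using False by (auto simp: \<rho>_def \<tau>_def remove_box_def)
      have rj: "removable \<rho> j" and rn: "removable \<tau> n"
        using j n False by (auto simp: removable_def \<rho>_def \<tau>_def remove_box_def)
      define \<sigma> where "\<sigma> = remove_box j \<rho>"
      have \<sigma>: "is_partition \<sigma>" "boxes \<sigma> < boxes \<theta>"
        using partition_remove_box[OF \<rho>(1) rj] boxes_remove_box[OF \<rho>(1) rj] \<rho>(2)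
        by (auto simp: \<sigma>_def)
      have "downstream e j (?A \<sigma>) (?A \<rho>)" "downstream e n (?A \<sigma>) (?A \<tau>)"
        using IH(3)[OF \<rho> rj] IH(3)[OF \<tau> rn] eq by (auto simp: \<sigma>_def)
      then obtain W where "downstream e n (?A \<rho>) W" "downstream e j (?A \<tau>) W"
        using downstream_diamond[OF IH(1)[OF \<sigma>] j1 n1 False] by blast
      moreover have "W = ?A \<theta>" using calculation(1) last by (rule downstream_functional)
      ultimately show ?thesis by (simp add: \<tau>_def)
    qed
    have only: "removable \<theta> j" if j: "1 \<le> j" and B: "is_abacus l B" "downstream e j B (?A \<theta>)" for j B
    proof (rule ccontr)
      assume not: "\<not> removable \<theta> j"
      then have jn: "j \<noteq> n" using n(1) by auto
      obtain X where X: "is_abacus l X" "downstream e j X (?A \<rho>)" "downstream e n X B"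
        using downstream_codiamond[OF IH(1)[OF \<rho>] B(1) j n1 jn last B(2)] by blast
      then have rj: "removable \<rho> j" using IH(2)[OF \<rho> j] by blast
      \<comment> \<open>A row removable in \<rho> but not in \<theta> must be row n - 1, of the same
        length as row n in \<theta>. Removing its box too makes both rows equal again, so n is not
        movable there.\<close>
      then have Suc: "n = Suc j" and eq: "\<theta> j = \<theta> n"
        using not jn partition_antimono[OF less(2) j, of "Suc j"]
        by (auto simp: removable_def \<rho>_def remove_box_def split: if_splits)
      define \<sigma> where "\<sigma> = remove_box j \<rho>"
      have \<sigma>: "is_partition \<sigma>" "boxes \<sigma> < boxes \<theta>"
        using partition_remove_box[OF \<rho>(1) rj] boxes_remove_box[OF \<rho>(1) rj] \<rho>(2)
        by (auto simp: \<sigma>_def)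
      have "X = ?A \<sigma>"
        using downstream_injective[OF X(1) IH(1)[OF \<sigma>] j X(2)] IH(3)[OF \<rho> rj] by (simp add: \<sigma>_def)
      then have "movable (?A \<sigma>) (j + 1)"
        using X(3) downstream_iff[OF X(1) n1] Suc by simp
      then have "removable \<sigma> j"
        using exists_downstream_iff[OF IH(1)[OF \<sigma>] j] IH(2)[OF \<sigma> j] by simp
      then show False
        using eq jn Suc by (auto simp: removable_def \<sigma>_def \<rho>_def remove_box_def)
    qed
    have pred_ab: "is_abacus l (?A (remove_box k \<theta>))" if "removable \<theta> k" for k
      using IH(1) partition_remove_box boxes_remove_box less(2) that by blast
    show ?thesis
    proof (intro conjI allI impI)
      show "is_abacus l (?A \<theta>)" by (rule ab)
      fix k :: nat assume k: "1 \<le> k"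
      show "(\<exists>B. is_abacus l B \<and> downstream e k B (?A \<theta>)) \<longleftrightarrow> removable \<theta> k"
        using only[OF k] rem pred_ab by blast
      show "downstream e k (?A (remove_box k \<theta>)) (?A \<theta>)" if "removable \<theta> k"
        by (rule rem[OF that])
    qed
  qed
qed

lemma b_op_abacus: "source H \<Longrightarrow> is_partition \<theta> \<Longrightarrow> is_abacus l (b_op e \<theta> H)"
  using crystal_structure by blast

lemma exists_downstream_b_op_iff:
  assumes "source H" "is_partition \<theta>" "1 \<le> k"
  shows "(\<exists>B. is_abacus l B \<and> downstream e k B (b_op e \<theta> H)) \<longleftrightarrow> removable \<theta> k"
  using crystal_structure[OF assms(1,2)] assms(3) by blast

lemma downstream_remove_box:
  assumes "source H" "is_partition \<theta>" "removable \<theta> k"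
  shows "downstream e k (b_op e (remove_box k \<theta>) H) (b_op e \<theta> H)"
  using crystal_structure[OF assms(1,2)] assms(3) by (simp add: removable_def)

lemma downstream_add_box:
  assumes "source H" "adds_box k \<theta> \<rho>"
  shows "downstream e k (b_op e \<theta> H) (b_op e \<rho> H)"
proof -
  have \<rho>: "is_partition \<theta>" "is_partition \<rho>" "\<rho> = \<theta>(k := \<theta> k + 1)" "1 \<le> k"
    using assms by (auto simp: adds_box_def)
  have "removable \<rho> k"
    using \<rho> partition_antimono[OF \<rho>(1,4), of "Suc k"] by (simp add: removable_def)
  moreover have "remove_box k \<rho> = \<theta>" using \<rho> by (auto simp: remove_box_def)
  ultimately show ?thesis using downstream_remove_box[OF assms(1) \<rho>(2)] by auto
qed

lemma downstream_imp_adds_box: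
  assumes H: "source H" and \<theta>: "is_partition \<theta>" and k: "1 \<le> k"
    and down: "downstream e k (b_op e \<theta> H) A'"
  shows "adds_box k \<theta> (\<theta>(k := \<theta> k + 1))" "A' = b_op e (\<theta>(k := \<theta> k + 1)) H"
proof -
  note ab = b_op_abacus[OF H \<theta>]
  have "movable (b_op e \<theta> H) k" using down downstream_iff[OF ab k] by blast
  then have less: "\<theta> k < \<theta> (k - 1)" if "k \<noteq> 1"
    using exists_downstream_iff[OF ab, of "k - 1"] exists_downstream_b_op_iff[OF H \<theta>, of "k - 1"]
      that k by (auto simp: removable_def)
  let ?\<rho> = "\<theta>(k := \<theta> k + 1)"
  have "finite {i. ?\<rho> i \<noteq> 0}"
    by (rule finite_subset[of _ "insert k {i. \<theta> i \<noteq> 0}"]) (use \<theta> in \<open>auto simp: is_partition_def\<close>)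
  moreover have "?\<rho> (Suc i) \<le> ?\<rho> i" if "1 \<le> i" for i
  proof -
    have "\<theta> (Suc i) \<le> \<theta> i" using \<theta> that by (simp add: is_partition_def)
    then show ?thesis using less that by (cases "Suc i = k") auto
  qed
  ultimately have "is_partition ?\<rho>" using \<theta> k by (auto simp: is_partition_def)
  then show box: "adds_box k \<theta> ?\<rho>" using \<theta> k by (simp add: adds_box_def)
  show "A' = b_op e ?\<rho> H"
    using down downstream_add_box[OF H box] by (rule downstream_functional)
qed

text \<open>Used with m such that all columns up to m are full: a step upstream brings beads closer
  to column m, so going upstream terminates.\<close>

definition energy :: "int \<Rightarrow> bead set \<Rightarrow> nat" where
  "energy m A = (\<Sum>b\<in>{b \<in> A. m < fst b}. nat (fst b - m))"

lemma energy_decreases: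
  assumes A: "is_abacus l A" and full: "\<And>c j. c \<le> m \<Longrightarrow> j \<in> {1..l} \<Longrightarrow> (c, j) \<in> A"
    and k: "1 \<le> k" and B: "is_abacus l B" "downstream e k B A"
  shows "energy m B < energy m A" "\<And>c j. c \<le> m \<Longrightarrow> j \<in> {1..l} \<Longrightarrow> (c, j) \<in> B"
proof -
  let ?Q = "aft_period e A k"
  let ?M = "move (-1) ?Q"
  note Q = bottomD[OF aft_bottom[OF A k]]
  have QA: "set ?Q \<subseteq> A" using Q(2) by (auto simp: rest_def)
  have up: "upstream e k B A" using downstream_iff_upstream[OF B(1) A k] B(2) by simp
  have B_eq: "B = A - set ?Q \<union> set ?M" and dis: "set ?M \<inter> (A - set ?Q) = {}"
    using upstreamD(1,2)[OF up] unfolding left_shiftable_iff[OF Q(1)] shift_left_def by blast+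
  \<comment> \<open>Left-shiftability puts a space just left of Q in each row it meets, and this
    space lies right of m. So no bead enters the full region.\<close>
  have M_col: "m < c" if cr: "(c, r) \<in> set ?M" for c r
  proof -
    have mem: "(c + 1, r) \<in> set ?Q" using cr by (simp add: set_move)
    have fin: "finite {c. (c, r) \<in> set ?Q}"
      by (rule finite_subset[of _ "fst ` set ?Q"]) force+
    have "(Min {c. (c, r) \<in> set ?Q} - 1, r) \<notin> A"
      using upstreamD(1)[OF up] mem by (force simp: left_shiftable_def)
    moreover have "r \<in> {1..l}" using mem QA A by (auto simp: is_abacus_def)
    ultimately have "m < Min {c. (c, r) \<in> set ?Q} - 1"
      using full by (meson not_less)
    moreover have "Min {c. (c, r) \<in> set ?Q} \<le> c + 1" using mem by (intro Min_le fin) simp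
    ultimately show ?thesis by simp
  qed
  have Q_col: "m + 1 < c" if "(c, r) \<in> set ?Q" for c r
    using M_col[of "c - 1" r] that by (simp add: set_move)
  show "(c, j) \<in> B" if "c \<le> m" "j \<in> {1..l}" for c j
    using full[OF that] Q_col[of c j] that(1) B_eq by auto
  let ?w = "\<lambda>b. nat (fst b - m)"
  let ?R = "{b \<in> A - set ?Q. m < fst b}"
  have finR: "finite ?R"
    by (rule finite_subset[OF _ is_abacus_finite[OF A, of m]]) auto
  have "{b \<in> A. m < fst b} = ?R \<union> set ?Q" "{b \<in> B. m < fst b} = ?R \<union> set ?M"
    using QA Q_col M_col B_eq by force+
  moreover have "?R \<inter> set ?Q = {}" "?R \<inter> set ?M = {}" using dis by auto
  ultimately have energies: "energy m A = sum ?w ?R + sum ?w (set ?Q)"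
    "energy m B = sum ?w ?R + sum ?w (set ?M)"
    using finR by (simp_all add: energy_def sum.union_disjoint)
  let ?s = "\<lambda>b::bead. (fst b - 1, snd b)"
  have "set ?M = ?s ` set ?Q" by (auto simp: move_def case_prod_beta image_def)
  moreover have "inj_on ?s (set ?Q)" by (auto simp: inj_on_def prod_eq_iff)
  ultimately have "sum ?w (set ?M) = (\<Sum>b\<in>set ?Q. ?w (?s b))" by (simp add: sum.reindex)
  also have "\<dots> < sum ?w (set ?Q)"
  proof (rule sum_strict_mono)
    show "set ?Q \<noteq> {}" using chain_inter_self[OF Q(1)] by auto
    show "?w (?s b) < ?w b" if "b \<in> set ?Q" for b
      using Q_col[of "fst b" "snd b"] that by simp
  qed simp
  finally show "energy m B < energy m A" using energies by simp
qed

lemma exists_coordinates: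
  assumes "is_abacus l A"
  obtains \<theta> H where "is_partition \<theta>" "source H" "A = b_op e \<theta> H"
proof -
  obtain m where full: "\<And>c j. c \<le> m \<Longrightarrow> j \<in> {1..l} \<Longrightarrow> (c, j) \<in> A"
    using is_abacus_columns[OF assms] by metis
  have "\<exists>\<theta> H. is_partition \<theta> \<and> source H \<and> A = b_op e \<theta> H"
    using assms full
  proof (induction "energy m A" arbitrary: A rule: less_induct)
    case less
    show ?case
    proof (cases "source A")
      case True
      have "is_partition (\<lambda>_. 0)" by (simp add: is_partition_def)
      then show ?thesis using True by (intro exI[of _ "\<lambda>_. 0"] exI[of _ A]) simp
    next
      case False
      then obtain k B where k: "1 \<le> k" and B: "is_abacus l B" "downstream e k B A"
        using less(2) by (auto simp: source_def)
      have dec: "energy m B < energy m A"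
        by (rule energy_decreases(1)[OF less(2) _ k B]) (rule less(3))
      have "(c, j) \<in> B" if "c \<le> m" "j \<in> {1..l}" for c j
        by (rule energy_decreases(2)[OF less(2) _ k B that]) (rule less(3))
      then obtain \<theta> H where "is_partition \<theta>" "source H" "B = b_op e \<theta> H"
        using less(1)[OF dec B(1)] by blast
      then show ?thesis
        using downstream_imp_adds_box[of H \<theta> k A] k B(2) unfolding adds_box_def by blast
    qed
  qed
  then show thesis using that by blast
qed

text \<open>The removable rows are read off the abacus as entering indices, so both partitions share
  a removable row; stripping that box on both sides leaves fewer boxes.\<close>

lemma coordinates_unique:
  assumes "source H" "source H'"
  shows "is_partition \<theta> \<Longrightarrow> is_partition \<theta>' \<Longrightarrow> b_op e \<theta> H = b_op e \<theta>' H' \<Longrightarrow> \<theta> = \<theta>' \<and> H = H'"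
proof (induction "boxes \<theta>" arbitrary: \<theta> \<theta>' rule: less_induct)
  case less
  have removable_iff: "removable \<theta> k \<longleftrightarrow> removable \<theta>' k" for k
  proof (cases "1 \<le> k")
    case True
    then show ?thesis using less(2-4) exists_downstream_b_op_iff assms by metis
  qed (simp add: removable_def)
  show ?case
  proof (cases "\<theta> = (\<lambda>_. 0)")
    case True
    then have "\<theta>' = (\<lambda>_. 0)"
      using removable_iff last_row[OF less(3)] by (metis less_irrefl removable_def)
    then show ?thesis using True less(4) by simp
  next
    case False
    then obtain n where n: "removable \<theta> n" using last_row[OF less(2)] by blast
    then have n': "removable \<theta>' n" using removable_iff by simp
    note p = partition_remove_box[OF less(2) n] partition_remove_box[OF less(3) n']
    have "1 \<le> n" using n by (simp add: removable_def)
    then have "b_op e (remove_box n \<theta>) H = b_op e (remove_box n \<theta>') H'"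
      using downstream_remove_box[OF assms(1) less(2) n] downstream_remove_box[OF assms(2) less(3) n']
        less(4) downstream_injective[OF b_op_abacus[OF assms(1) p(1)] b_op_abacus[OF assms(2) p(2)]]
      by simp
    then have "remove_box n \<theta> = remove_box n \<theta>'" "H = H'"
      using less(1)[OF boxes_remove_box[OF less(2) n] p] by auto
    moreover have "\<theta> n = remove_box n \<theta> n + 1" "\<theta>' n = remove_box n \<theta>' n + 1"
      using n n' by (auto simp: remove_box_def removable_def)
    ultimately have "\<theta> i = \<theta>' i" for i
      by (cases "i = n") (metis, metis fun_upd_other remove_box_def)
    then show ?thesis using \<open>H = H'\<close> by auto
  qed
qed

text \<open>Adding the rows of \<sigma> to \<theta> box by box passes only through partitions, so
  each shift along the way adds one box.\<close>

lemma b_op_b_op: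
  assumes H: "source H" and \<theta>: "is_partition \<theta>" and \<sigma>: "is_partition \<sigma>"
  shows "b_op e \<sigma> (b_op e \<theta> H) = b_op e (\<lambda>i. \<theta> i + \<sigma> i) H"
proof -
  \<comment> \<open>The state after n complete rows of \<sigma> and m shifts in row n + 1.\<close>
  define \<tau> where "\<tau> n m i = \<theta> i + (if i \<le> n then \<sigma> i else if i = Suc n then m else 0)" for n m i
  have part: "is_partition (\<tau> n m)" if "m \<le> \<sigma> (Suc n)" for n m
  proof -
    have "finite {i. \<tau> n m i \<noteq> 0}"
      by (rule finite_subset[of _ "{i. \<theta> i \<noteq> 0} \<union> {..Suc n}"])
        (use \<theta> in \<open>auto simp: is_partition_def \<tau>_def split: if_splits\<close>)
    moreover have "\<tau> n m (Suc i) \<le> \<tau> n m i" if "1 \<le> i" for i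
    proof -
      have "\<theta> (Suc i) \<le> \<theta> i" "\<sigma> (Suc i) \<le> \<sigma> i" using \<theta> \<sigma> that by (auto simp: is_partition_def)
      then show ?thesis using \<open>m \<le> \<sigma> (Suc n)\<close>
        by (cases "i = n") (auto simp: \<tau>_def not_le le_Suc_eq)
    qed
    ultimately show ?thesis using \<theta> \<sigma> by (auto simp: is_partition_def \<tau>_def)
  qed
  have row: "((\<lambda>B. shift_right B (fore_period e B (Suc n))) ^^ m) (b_op e (\<tau> n 0) H) = b_op e (\<tau> n m) H"
    if "m \<le> \<sigma> (Suc n)" for n m
    using that
  proof (induction m)
    case (Suc m)
    have eq: "\<tau> n (Suc m) = (\<tau> n m)(Suc n := \<tau> n m (Suc n) + 1)" by (auto simp: \<tau>_def)
    have "adds_box (Suc n) (\<tau> n m) (\<tau> n (Suc m))"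
      unfolding adds_box_def by (intro conjI part eq) (use Suc(2) in auto)
    then have "b_op e (\<tau> n (Suc m)) H =
        shift_right (b_op e (\<tau> n m) H) (fore_period e (b_op e (\<tau> n m) H) (Suc n))"
      by (rule downstreamD(2)[OF downstream_add_box[OF H]])
    then show ?case using Suc by simp
  qed simp
  have rows: "b_rows e \<sigma> n (b_op e \<theta> H) = b_op e (\<tau> n 0) H" for n
  proof (induction n)
    case 0
    have "\<tau> 0 0 = \<theta>" using \<sigma> by (auto simp: \<tau>_def is_partition_def)
    then show ?case by simp
  next
    case (Suc n)
    have "\<tau> n (\<sigma> (Suc n)) = \<tau> (Suc n) 0" by (auto simp: \<tau>_def le_Suc_eq)
    then show ?case using Suc row[of "\<sigma> (Suc n)" n] by simp
  qed
  have "\<tau> (card {i. \<sigma> i \<noteq> 0}) 0 = (\<lambda>i. \<theta> i + \<sigma> i)"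
  proof
    fix i
    have "\<sigma> i \<noteq> 0 \<longleftrightarrow> 1 \<le> i \<and> i \<le> card {i. \<sigma> i \<noteq> 0}"
      using partition_support[OF \<sigma>] by auto
    then show "\<tau> (card {i. \<sigma> i \<noteq> 0}) 0 i = \<theta> i + \<sigma> i" using \<sigma> by (auto simp: \<tau>_def is_partition_def)
  qed
  then show ?thesis using rows by (simp add: b_op_def[of e \<sigma>])
qed

text \<open>A vertex obtained from B by a nonempty \<sigma> has coordinates \<theta> + \<sigma> over
  the source of B; some row is removable, so an arrow enters.\<close>

lemma highest_weight_iff_source: "highest_weight e l H \<longleftrightarrow> source H"
proof
  assume hw: "highest_weight e l H"
  then have "is_abacus l H" by (simp add: highest_weight_def)
  then obtain \<theta> H0 where H0: "is_partition \<theta>" "source H0" "H = b_op e \<theta> H0"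
    by (rule exists_coordinates)
  then have "\<theta> = (\<lambda>_. 0)" using hw by (auto simp: highest_weight_def source_def)
  then show "source H" using H0 by simp
next
  assume src: "source H"
  have False if \<sigma>: "is_partition \<sigma>" "\<sigma> \<noteq> (\<lambda>_. 0)" and B: "is_abacus l B" "H = b_op e \<sigma> B" for \<sigma> B
  proof -
    obtain \<theta> B0 where B0: "is_partition \<theta>" "source B0" "B = b_op e \<theta> B0"
      using exists_coordinates[OF B(1)] by blast
    let ?\<tau> = "\<lambda>i. \<theta> i + \<sigma> i"
    have H: "H = b_op e ?\<tau> B0" using b_op_b_op B0 \<sigma>(1) B(2) by simp
    have "is_partition ?\<tau>"
      using B0(1) \<sigma>(1) by (auto simp: is_partition_def intro: add_mono
          finite_subset[of _ "{i. \<theta> i \<noteq> 0} \<union> {i. \<sigma> i \<noteq> 0}"])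
    moreover have "?\<tau> \<noteq> (\<lambda>_. 0)" using \<sigma>(2) by (auto simp: fun_eq_iff)
    ultimately obtain n where "removable ?\<tau> n" "is_partition ?\<tau>" using last_row by blast
    then have "\<exists>C. is_abacus l C \<and> downstream e n C H"
      using exists_downstream_b_op_iff[OF B0(2), of ?\<tau> n] H by (simp add: removable_def)
    then show False using src \<open>removable ?\<tau> n\<close> by (auto simp: source_def removable_def)
  qed
  then show "highest_weight e l H" using src by (auto simp: highest_weight_def source_def)
qed

lemma crystal_coords_eq:
  assumes "is_partition \<theta>" "source H" shows "crystal_coords e l (b_op e \<theta> H) = (\<theta>, H)"
  unfolding crystal_coords_def highest_weight_iff_source
  using coordinates_unique assms by (intro the_equality) auto

end

section \<open>Charges and the crystal\<close>

text \<open>These are the beta-numbers of a partition. A new largest bead adds a first part and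
  raises the charge by one, so the older parts merely move down one index.\<close>

lemma exists_partition_of_row:
  fixes F :: "int set"
  assumes "finite F" "\<And>x. x \<in> F \<Longrightarrow> m < x"
  shows "\<exists>lam. is_partition lam \<and>
    {..m} \<union> F = {int (lam k) + (m + int (card F)) - int k + 1 | k. 1 \<le> k}"
  using assms
proof (induction F rule: finite_linorder_max_induct)
  case empty
  have "{..m} = {m - int k + 1 | k. 1 \<le> k}"
  proof (intro set_eqI iffI)
    fix x assume "x \<in> {..m}"
    then have "x = m - int (nat (m - x + 1)) + 1 \<and> 1 \<le> nat (m - x + 1)" by auto
    then show "x \<in> {m - int k + 1 | k. 1 \<le> k}" by blast
  qed auto
  then show ?case by (intro exI[of _ "\<lambda>_. 0"]) (simp add: is_partition_def)
next
  case (insert b F)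
  let ?R = "{..m} \<union> F"
  define s where "s = m + int (card F)"
  obtain lam where lam: "is_partition lam" "?R = {int (lam k) + s - int k + 1 | k. 1 \<le> k}"
    using insert(3,4) unfolding s_def by auto
  have "int (lam 1) + s - int 1 + 1 \<in> ?R" unfolding lam(2) by blast
  then have less: "int (lam 1) + s < b" using insert(2) insert(4)[of b] by auto
  \<comment> \<open>The new part b - s - 1 is the number of spaces between columns m and b.\<close>
  define lam' where "lam' k = (if k = 0 then 0 else if k = 1 then nat (b - s - 1) else lam (k - 1))" for k
  have "finite {i. lam' i \<noteq> 0}"
    by (rule finite_subset[of _ "{0, 1} \<union> Suc ` {i. lam i \<noteq> 0}"])
      (use lam(1) in \<open>auto simp: is_partition_def lam'_def image_def intro: Suc_pred'\<close>)
  moreover have "lam' (Suc i) \<le> lam' i" if "1 \<le> i" for i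
  proof (cases "i = 1")
    case True
    then show ?thesis using less by (simp add: lam'_def)
  next
    case False
    then obtain k where k: "i = Suc k" "1 \<le> k" using \<open>1 \<le> i\<close> by (cases i) auto
    then have "lam (Suc k) \<le> lam k" using lam(1) by (simp add: is_partition_def)
    then show ?thesis using k by (simp add: lam'_def)
  qed
  ultimately have "is_partition lam'" by (simp add: is_partition_def lam'_def)
  moreover have "{..m} \<union> insert b F = {int (lam' k) + (s + 1) - int k + 1 | k. 1 \<le> k}" (is "?L = ?S")
  proof -
    have first: "int (lam' 1) + (s + 1) - int 1 + 1 = b" using less by (simp add: lam'_def)
    have next_row: "int (lam' (Suc k)) + (s + 1) - int (Suc k) + 1 = int (lam k) + s - int k + 1"
      if "1 \<le> k" for k using that by (simp add: lam'_def)
    have "?L = insert b ?R" by auto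
    also have "\<dots> = ?S"
    proof (intro set_eqI iffI)
      fix x assume "x \<in> insert b ?R"
      then consider "x = b" | k where "1 \<le> k" "x = int (lam k) + s - int k + 1"
        using lam(2) by blast
      then show "x \<in> ?S"
      proof cases
        case 1
        then have "x = int (lam' 1) + (s + 1) - int 1 + 1" using first by simp
        then show ?thesis by blast
      next
        case 2
        then have "x = int (lam' (Suc k)) + (s + 1) - int (Suc k) + 1 \<and> 1 \<le> Suc k"
          using next_row by simp
        then show ?thesis by blast
      qed
    next
      fix x assume "x \<in> ?S"
      then obtain k where k: "1 \<le> k" "x = int (lam' k) + (s + 1) - int k + 1" by blast
      show "x \<in> insert b ?R"
      proof (cases "k = 1")
        case True
        then show ?thesis using first k by simp
      next
        case False
        then obtain i where "k = Suc i" "1 \<le> i" using k(1) by (cases k) auto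
        then show ?thesis using next_row k(2) lam(2) by blast
      qed
    qed
    finally show ?thesis .
  qed
  moreover have "m + int (card (insert b F)) = s + 1"
    using insert(1,2) by (auto simp: s_def)
  ultimately show ?case by auto
qed

lemma has_charge_count:
  assumes A: "is_abacus l A" and full: "\<And>c j. c \<le> m \<Longrightarrow> j \<in> {1..l} \<Longrightarrow> (c, j) \<in> A"
  shows "has_charge l A (\<lambda>j. m + int (card {c. m < c \<and> (c, j) \<in> A}))"
proof -
  let ?F = "\<lambda>j. {c. m < c \<and> (c, j) \<in> A}"
  have "\<forall>j. \<exists>lam. is_partition lam \<and>
      {..m} \<union> ?F j = {int (lam k) + (m + int (card (?F j))) - int k + 1 | k. 1 \<le> k}"
  proof (rule allI, rule exists_partition_of_row)
    fix j
    show "finite (?F j)"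
      by (rule finite_subset[of _ "fst ` {b \<in> A. m \<le> fst b}"])
        (force simp: is_abacus_finite[OF A])+
  qed simp
  from choice[OF this] obtain lam where lam_all: "\<forall>j. is_partition (lam j) \<and>
    {..m} \<union> ?F j = {int (lam j k) + (m + int (card (?F j))) - int k + 1 | k. 1 \<le> k}"
    by (elim exE)
  note lam = spec[OF lam_all, THEN conjunct1] spec[OF lam_all, THEN conjunct2]
  have "A = abacus_of l lam (\<lambda>j. m + int (card (?F j)))"
  proof (intro set_eqI iffI; clarify)
    fix c j assume cj: "(c, j) \<in> A"
    then have "j \<in> {1..l}" using A by (auto simp: is_abacus_def)
    moreover have "c \<in> {..m} \<union> ?F j" using cj by auto
    ultimately show "(c, j) \<in> abacus_of l lam (\<lambda>j. m + int (card (?F j)))"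
      unfolding lam(2) abacus_of_def by blast
  next
    fix c j assume "(c, j) \<in> abacus_of l lam (\<lambda>j. m + int (card (?F j)))"
    then have j: "j \<in> {1..l}"
      and "c \<in> {int (lam j k) + (m + int (card (?F j))) - int k + 1 | k. 1 \<le> k}"
      unfolding abacus_of_def by blast+
    then have "c \<in> {..m} \<union> ?F j" unfolding lam(2) by blast
    then show "(c, j) \<in> A" using full j by auto
  qed
  then show ?thesis unfolding has_charge_def using lam(1) by blast
qed

section \<open>Arrows, charges and the operators on abaci\<close>

context abaci
begin

text \<open>One cutoff m serves both abaci. Beads stay in their rows and none lands on another, so
  each row keeps its number of beads right of m.\<close>

lemma downstream_same_charge:
  assumes A: "is_abacus l A" and k: "1 \<le> k" and down: "downstream e k A A'"
  obtains s where "has_charge l A s" "has_charge l A' s"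
proof -
  let ?P = "fore_period e A k"
  note P = fore_chain[OF A k]
  have A': "A' = A - set ?P \<union> set (move 1 ?P)" and dis: "set (move 1 ?P) \<inter> (A - set ?P) = {}"
    using downstreamD(1,2)[OF down] unfolding right_shiftable_iff[OF P] shift_right_def by blast+
  note ab = downstream_abacus[OF A k down]
  obtain m1 where m1: "\<And>c j. c \<le> m1 \<Longrightarrow> j \<in> {1..l} \<Longrightarrow> (c, j) \<in> A"
    using is_abacus_columns[OF A] by metis
  obtain m2 where m2: "\<And>c j. c \<le> m2 \<Longrightarrow> j \<in> {1..l} \<Longrightarrow> (c, j) \<in> A'"
    using is_abacus_columns[OF ab] by metis
  define m where "m = min (min m1 m2) (start ?P - int e)"
  have col: "m < c" if "(c, j) \<in> set ?P" for c j
    using that by (auto simp: chain_mem[OF P] m_def)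
  have "card {c. m < c \<and> (c, j) \<in> A'} = card {c. m < c \<and> (c, j) \<in> A}" for j
  proof -
    let ?F = "{c. m < c \<and> (c, j) \<in> A}" and ?p = "{c. (c, j) \<in> set ?P}"
    have fin: "finite ?F"
      by (rule finite_subset[of _ "fst ` {b \<in> A. m \<le> fst b}"])
        (force simp: is_abacus_finite[OF A])+
    have sub: "?p \<subseteq> ?F" using col fore_subset[OF A k] by auto
    have "{c. m < c \<and> (c, j) \<in> A'} = (?F - ?p) \<union> (\<lambda>c. c + 1) ` ?p"
    proof (intro set_eqI)
      fix c
      have "c \<in> (\<lambda>c. c + 1) ` ?p \<longleftrightarrow> (c, j) \<in> set (move 1 ?P)"
        by (auto simp: set_move image_iff intro: exI[of _ "c - 1"])
      moreover have "(c, j) \<in> set (move 1 ?P) \<Longrightarrow> m < c"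
        using col[of "c - 1" j] by (simp add: set_move)
      ultimately show "c \<in> {c. m < c \<and> (c, j) \<in> A'} \<longleftrightarrow> c \<in> (?F - ?p) \<union> (\<lambda>c. c + 1) ` ?p"
        using A' by auto
    qed
    moreover have "(?F - ?p) \<inter> (\<lambda>c. c + 1) ` ?p = {}"
      using dis by (auto simp: set_move disjoint_iff)
    ultimately have "card {c. m < c \<and> (c, j) \<in> A'} = card (?F - ?p) + card ((\<lambda>c. c + 1) ` ?p)"
      using fin sub by (simp add: card_Un_disjoint finite_subset)
    also have "card ((\<lambda>c. c + 1) ` ?p) = card ?p" by (rule card_image) (simp add: inj_on_def)
    also have "card (?F - ?p) + card ?p = card ?F"
      using fin sub by (simp add: card_Diff_subset finite_subset card_mono)
    finally show ?thesis .
  qed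
  moreover have "has_charge l A (\<lambda>j. m + int (card {c. m < c \<and> (c, j) \<in> A}))"
    by (rule has_charge_count[OF A]) (use m1 in \<open>auto simp: m_def\<close>)
  moreover have "has_charge l A' (\<lambda>j. m + int (card {c. m < c \<and> (c, j) \<in> A'}))"
    by (rule has_charge_count[OF ab]) (use m2 in \<open>auto simp: m_def\<close>)
  ultimately show thesis using that by simp
qed

lemma crystal_arrow_iff:
  assumes A: "is_abacus l A"
  shows "(\<exists>s. (A, A') \<in> crystal_arrows e l s) \<longleftrightarrow> (\<exists>k\<ge>1. downstream e k A A')"
proof
  assume "\<exists>s. (A, A') \<in> crystal_arrows e l s"
  then obtain H \<theta> \<rho> k where "source H" "adds_box k \<theta> \<rho>" "A = b_op e \<theta> H" "A' = b_op e \<rho> H"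
    unfolding crystal_arrows_def highest_weight_iff_source by blast
  then show "\<exists>k\<ge>1. downstream e k A A'"
    using downstream_add_box by (auto simp: adds_box_def)
next
  assume "\<exists>k\<ge>1. downstream e k A A'"
  then obtain k where k: "1 \<le> k" "downstream e k A A'" by blast
  obtain \<theta> H where H: "is_partition \<theta>" "source H" "A = b_op e \<theta> H"
    using exists_coordinates[OF A] by blast
  obtain s where "has_charge l A s" "has_charge l A' s"
    using downstream_same_charge[OF A k] by blast
  then show "\<exists>s. (A, A') \<in> crystal_arrows e l s"
    unfolding crystal_arrows_def highest_weight_iff_source
    using downstream_imp_adds_box[OF H(2,1) k(1)] k(2) H by blast
qed

lemma Upsilon_plus_iff:
  assumes "is_abacus l A" "1 \<le> k"
  shows "Upsilon_plus e l k A = Some A' \<longleftrightarrow> downstream e k A A'"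
proof -
  obtain \<theta> H where H: "is_partition \<theta>" "source H" "A = b_op e \<theta> H"
    using exists_coordinates[OF assms(1)] by blast
  have "Upsilon_plus e l k A = (if adds_box k \<theta> (\<theta>(k := \<theta> k + 1))
      then Some (b_op e (\<theta>(k := \<theta> k + 1)) H) else None)"
    unfolding Upsilon_plus_def H(3) crystal_coords_eq[OF H(1,2)] by simp
  then show ?thesis
    using downstream_imp_adds_box[OF H(2,1) assms(2), of A'] downstream_add_box[OF H(2)] H(3)
    by (auto split: if_splits)
qed

lemma Upsilon_minus_iff:
  assumes A: "is_abacus l A" and A': "is_abacus l A'" and k: "1 \<le> k"
  shows "Upsilon_minus e l k A' = Some A \<longleftrightarrow> downstream e k A A'"
proof -
  obtain \<rho> H where H: "is_partition \<rho>" "source H" "A' = b_op e \<rho> H"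
    using exists_coordinates[OF A'] by blast
  let ?\<theta> = "\<rho>(k := \<rho> k - 1)"
  have minus: "Upsilon_minus e l k A' = (if adds_box k ?\<theta> \<rho> then Some (b_op e ?\<theta> H) else None)"
    unfolding Upsilon_minus_def H(3) crystal_coords_eq[OF H(1,2)] by simp
  show ?thesis
  proof
    assume "Upsilon_minus e l k A' = Some A"
    then show "downstream e k A A'"
      using minus downstream_add_box[OF H(2), of k ?\<theta> \<rho>] H(3) by (auto split: if_splits)
  next
    assume down: "downstream e k A A'"
    then have rem: "removable \<rho> k" using exists_downstream_b_op_iff[OF H(2,1) k] A H(3) by blast
    note \<theta> = partition_remove_box[OF H(1) rem]
    have "adds_box k ?\<theta> \<rho>"
      using \<theta> H(1) rem by (auto simp: adds_box_def remove_box_def removable_def)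
    moreover have "A = b_op e ?\<theta> H"
      using downstream_injective[OF A b_op_abacus[OF H(2) \<theta>] k down]
        downstream_remove_box[OF H(2,1) rem] H(3) by (simp add: remove_box_def)
    ultimately show "Upsilon_minus e l k A' = Some A" using minus by simp
  qed
qed

end

theorem theorem3p14:
  fixes e l :: nat and A A' :: "bead set"
  assumes "e \<ge> 2" and "l \<ge> 2" and "is_abacus l A" and "is_abacus l A'"
  shows "((\<exists>s. (A, A') \<in> crystal_arrows e l s) \<longleftrightarrow> (\<exists>k\<ge>1. downstream e k A A'))
    \<and> ((\<exists>s. (A, A') \<in> crystal_arrows e l s) \<longleftrightarrow> (\<exists>k\<ge>1. upstream e k A A'))
    \<and> (\<forall>k\<ge>1. downstream e k A A' \<longleftrightarrow> upstream e k A A')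
    \<and> (\<forall>k\<ge>1. downstream e k A A' \<longrightarrow>
          Upsilon_plus e l k A = Some A' \<and> Upsilon_minus e l k A' = Some A)
    \<and> (\<forall>k\<ge>1. Upsilon_plus e l k A = Some A' \<longleftrightarrow> Upsilon_minus e l k A' = Some A)"
proof -
  interpret abaci e l using assms by unfold_locales auto
  show ?thesis
    using crystal_arrow_iff[OF assms(3), of A'] downstream_iff_upstream[OF assms(3,4)]
      Upsilon_plus_iff[OF assms(3), of _ A'] Upsilon_minus_iff[OF assms(3,4)]
    by blast
qed

end
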